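(* (Linear filtering equation for homodyne detection.) In the repeated interaction model of the context with homodyne observations $\Delta Y(l)=U(l)^*(\Delta A(l)+\Delta A^*(l))U(l)$, define for $X\in\mathscr{M}$ the unnormalized conditional expectation $$\sigma_l(X)=U(l)^*\,\mathbb{P}(V(l)^*XV(l)|\mathscr{C}_l)\,U(l)\in\mathscr{Y}_l,\qquad 0\le l\le k .$$ Then for all $X\in\mathscr{M}$ and $1\le l\le k$, $$\Delta\sigma_l(X)=\sigma_{l-1}(\mathcal{L}(X))\,\Delta t(l)+\sigma_{l-1}(\mathcal{J}(X))\,\Delta Y(l),\qquad \sigma_0(X)=\rho(X),$$ where $\Delta\sigma_l(X)=\sigma_l(X)-\sigma_{l-1}(X)$, $\mathcal{L}(X)=M^{+*}XM^++\lambda^2M^{\circ*}XM^\circ+M^{\circ*}X+XM^\circ$ and $\mathcal{J}(X)=XM^++M^{+*}X+\lambda^2M^{\circ*}XM^++\lambda^2M^{+*}XM^\circ$. Furthermore, the noncommutative Kallianpur-Striebel formula holds: for all $X\in\mathscr{M}$ and $0\le l\le k$, with probability one, $$\pi_l(X)=\frac{\sigma_l(X)}{\sigma_l(I)},\qquad\text{where }\pi_l(X)=\mathbb{P}(j_l(X)|\mathscr{Y}_l).$$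
   Context: Let $\mathscr{M}=M_2(\mathbb{C})$, $\sigma_-=\begin{pmatrix}0&0\\1&0\end{pmatrix}$, $\sigma_+=\sigma_-^*$, $\Phi=(0,1)^T$, $\phi(X)=\langle\Phi,X\Phi\rangle$. Fix $k\in\mathbb{N}$, $T>0$, $\lambda=\sqrt{T/k}$, a state $\rho$ on $\mathscr{M}$, $\mathscr{W}_k=\mathscr{M}^{\otimes k}$, and the state $\mathbb{P}=\rho\otimes\phi^{\otimes k}$ on $\mathscr{M}\otimes\mathscr{W}_k$. Identify $X\in\mathscr{M}$ with $X\otimes I$. For $X\in\mathscr{M}$, $X_i$ denotes $X$ placed in the $i$-th factor of $\mathscr{W}_k$. Set $\Delta A(i)=\lambda(\sigma_-)_i$, $\Delta A^*(i)=\lambda(\sigma_+)_i$, $\Delta\Lambda(i)=(\sigma_+\sigma_-)_i$, $\Delta t(i)=\lambda^2I$. Repeated interaction: given $L_1,L_2,L_3\in\mathscr{M}$ with $L_1,L_3$ self-adjoint, let $M_l=\exp(-i\{L_1\Delta\Lambda(l)+L_2\Delta A^*(l)+L_2^*\Delta A(l)+L_3\Delta t(l)\})$, and let $M^{\pm},M^+,M^-,M^\circ\in\mathscr{M}$ be the unique matrices (independent of $l$) with $M_l-I=M^\pm\Delta\Lambda(l)+M^+\Delta A^*(l)+M^-\Delta A(l)+M^\circ\Delta t(l)$. Put $U(0)=I$, $U(l)=M_l\cdots M_1$, $j_l(X)=U(l)^*XU(l)$. $\mathscr{C}_l$ is the commutative $^*$-algebra generated by $I$ and $\Delta A(i)+\Delta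 A^*(i)$, $i=1,\ldots,l$; $\mathscr{Y}_l$ is the (commutative) $^*$-algebra generated by $I,\Delta Y(1),\ldots,\Delta Y(l)$; one has $\mathscr{Y}_l=U(l)^*\mathscr{C}_lU(l)$. $V(l)$ is defined by $V(0)=I$ and $V(l)-V(l-1)=\{M^+(\Delta A(l)+\Delta A^*(l))+M^\circ\Delta t(l)\}V(l-1)$; it commutes with every element of $\mathscr{C}_l$. Conditional expectation: for a commutative $^*$-subalgebra $\mathscr{C}$ with commutant $\mathscr{C}'$ and $B\in\mathscr{C}'$, a version of $\mathbb{P}(B|\mathscr{C})$ is any element of $\mathscr{C}$ with $\mathbb{P}(\mathbb{P}(B|\mathscr{C})C)=\mathbb{P}(BC)$ for all $C\in\mathscr{C}$. Equality "with probability one" of $P,Q\in\mathscr{C}$ means $\mathbb{P}((P-Q)^*(P-Q))=0$. Elements of a commutative algebra are identified with complex functions on a finite probability space, so quotients make sense pointwise (where defined). *)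

theory Defs
  imports Complex_Main "Jordan_Normal_Form.Schur_Decomposition"
begin

text \<open>Operators on the \<open>n\<close>-dimensional Hilbert space are complex \<open>n\<close> by \<open>n\<close> matrices. The
  tensor product of the system with the first \<open>k\<close> factors of the field has dimension
  \<open>2 ^ Suc k\<close>, tensor products being Kronecker products. Slot 0 is the initial system, and
  slots \<open>1, \<dots>, k\<close> are the field factors.\<close>

abbreviation M2 :: "complex mat set" where
  "M2 \<equiv> carrier_mat 2 2"

abbreviation fulldim :: "nat \<Rightarrow> nat" where
  "fulldim k \<equiv> 2 ^ Suc k"

definition kron :: "complex mat \<Rightarrow> complex mat \<Rightarrow> complex mat" where
  "kron A B = mat (dim_row A * dim_row B) (dim_col A * dim_col B)
     (\<lambda>(i, j). A $$ (i div dim_row B, j div dim_col B) * B $$ (i mod dim_row B, j mod dim_col B))"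

definition slot :: "nat \<Rightarrow> nat \<Rightarrow> complex mat \<Rightarrow> complex mat" where
  "slot k i A = kron (kron (1\<^sub>m (2 ^ i)) A) (1\<^sub>m (2 ^ (k - i)))"

abbreviation sys :: "nat \<Rightarrow> complex mat \<Rightarrow> complex mat" where
  "sys k X \<equiv> slot k 0 X"

text \<open>The exponential series; convergence in a finite-dimensional matrix space is entrywise.\<close>

definition mat_exp :: "complex mat \<Rightarrow> complex mat" where
  "mat_exp A = mat (dim_row A) (dim_col A) (\<lambda>(i, j). \<Sum>m. (A ^\<^sub>m m) $$ (i, j) / fact m)"


subsection \<open>States\<close>

text \<open>In \<open>0 \<le> f (mat_adjoint A * A)\<close> the order on \<open>complex\<close> is the one of
  \<^theory>\<open>HOL-Library.Complex_Order\<close>, so this says that the value is real and nonnegative.\<close>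

definition is_state :: "nat \<Rightarrow> (complex mat \<Rightarrow> complex) \<Rightarrow> bool" where
  "is_state n f \<longleftrightarrow>
     (\<forall>A \<in> carrier_mat n n. \<forall>B \<in> carrier_mat n n. f (A + B) = f A + f B) \<and>
     (\<forall>c. \<forall>A \<in> carrier_mat n n. f (c \<cdot>\<^sub>m A) = c * f A) \<and>
     (\<forall>A \<in> carrier_mat n n. 0 \<le> f (mat_adjoint A * A)) \<and>
     f (1\<^sub>m n) = 1"

definition vac_vec :: "complex vec" where
  "vac_vec = vec_of_list [0, 1]"

text \<open>The scalar product \<open>\<bullet>c\<close> is conjugate linear in its second argument, hence the order of
  the arguments.\<close>

definition vac_state :: "complex mat \<Rightarrow> complex" where
  "vac_state X = (X *\<^sub>v vac_vec) \<bullet>c vac_vec"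

text \<open>The tensor product of linear functionals \<open>f\<close> on \<open>m\<close> by \<open>m\<close> and \<open>g\<close> on \<open>n\<close> by \<open>n\<close>
  matrices, computed as \<open>f\<close> after the slice map \<open>id \<otimes> g\<close>: it is the linear functional
  that sends \<open>kron A B\<close> to \<open>f A * g B\<close>.\<close>

definition tensor_functional ::
  "nat \<Rightarrow> nat \<Rightarrow> (complex mat \<Rightarrow> complex) \<Rightarrow> (complex mat \<Rightarrow> complex) \<Rightarrow> complex mat \<Rightarrow> complex" where
  "tensor_functional m n f g Z =
     f (mat m m (\<lambda>(i, j). g (mat n n (\<lambda>(a, b). Z $$ (i * n + a, j * n + b)))))"

primrec prod_state :: "(complex mat \<Rightarrow> complex) \<Rightarrow> nat \<Rightarrow> complex mat \<Rightarrow> complex" where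
  "prod_state \<rho> 0 = \<rho>"
| "prod_state \<rho> (Suc k) = tensor_functional (fulldim k) 2 (prod_state \<rho> k) vac_state"


subsection \<open>Matrix *-algebras and conditional expectations\<close>

inductive_set star_alg :: "nat \<Rightarrow> complex mat set \<Rightarrow> complex mat set"
  for n :: nat and S :: "complex mat set" where
  one: "1\<^sub>m n \<in> star_alg n S"
| gen: "A \<in> S \<Longrightarrow> A \<in> star_alg n S"
| add: "A \<in> star_alg n S \<Longrightarrow> B \<in> star_alg n S \<Longrightarrow> A + B \<in> star_alg n S"
| smult: "A \<in> star_alg n S \<Longrightarrow> c \<cdot>\<^sub>m A \<in> star_alg n S"
| mult: "A \<in> star_alg n S \<Longrightarrow> B \<in> star_alg n S \<Longrightarrow> A * B \<in> star_alg n S"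
| adjoint: "A \<in> star_alg n S \<Longrightarrow> mat_adjoint A \<in> star_alg n S"

definition commutant :: "nat \<Rightarrow> complex mat set \<Rightarrow> complex mat set" where
  "commutant n C = {B \<in> carrier_mat n n. \<forall>A \<in> C. A * B = B * A}"

definition is_cond_exp ::
  "nat \<Rightarrow> (complex mat \<Rightarrow> complex) \<Rightarrow> complex mat set \<Rightarrow> complex mat \<Rightarrow> complex mat \<Rightarrow> bool" where
  "is_cond_exp n P C B E \<longleftrightarrow>
     B \<in> commutant n C \<and> E \<in> C \<and> (\<forall>A \<in> C. P (E * A) = P (B * A))"

definition as_eq :: "(complex mat \<Rightarrow> complex) \<Rightarrow> complex mat \<Rightarrow> complex mat \<Rightarrow> bool" where
  "as_eq P A B \<longleftrightarrow> P (mat_adjoint (A - B) * (A - B)) = 0"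

text \<open>A commutative *-algebra \<open>C\<close> of matrices containing the identity is identified with the
  functions on the finite probability space whose points are the minimal nonzero projections \<open>p\<close>
  of \<open>C\<close>. The point \<open>p\<close> has probability \<open>P p\<close>, and \<open>A \<in> C\<close> is the sum of \<open>val_at A p \<cdot>\<^sub>m p\<close> over
  all points \<open>p\<close>, where \<open>val_at A p\<close> is the value of the function \<open>A\<close> at \<open>p\<close>.\<close>

definition projections :: "complex mat set \<Rightarrow> complex mat set" where
  "projections C = {p \<in> C. mat_adjoint p = p \<and> p * p = p}"

definition points :: "nat \<Rightarrow> complex mat set \<Rightarrow> complex mat set" where
  "points n C = {p \<in> projections C. p \<noteq> 0\<^sub>m n n \<and>
     (\<forall>q \<in> projections C. q * p = q \<longrightarrow> q = 0\<^sub>m n n \<or> q = p)}"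

definition val_at :: "complex mat \<Rightarrow> complex mat \<Rightarrow> complex" where
  "val_at A p = (THE c. A * p = c \<cdot>\<^sub>m p)"

text \<open>\<open>Q\<close> is a pointwise quotient of \<open>A\<close> by \<open>B\<close>; its values are arbitrary where \<open>B\<close> vanishes.\<close>

definition is_quotient ::
  "nat \<Rightarrow> complex mat set \<Rightarrow> complex mat \<Rightarrow> complex mat \<Rightarrow> complex mat \<Rightarrow> bool" where
  "is_quotient n C A B Q \<longleftrightarrow>
     Q \<in> C \<and> (\<forall>p \<in> points n C. val_at B p \<noteq> 0 \<longrightarrow> val_at Q p = val_at A p / val_at B p)"

definition as_nonzero ::
  "nat \<Rightarrow> (complex mat \<Rightarrow> complex) \<Rightarrow> complex mat set \<Rightarrow> complex mat \<Rightarrow> bool" where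
  "as_nonzero n P C B \<longleftrightarrow> (\<forall>p \<in> points n C. val_at B p = 0 \<longrightarrow> P p = 0)"


subsection \<open>The repeated interaction model\<close>

definition sigma_minus :: "complex mat" where
  "sigma_minus = mat_of_rows_list 2 [[0, 0], [1, 0]]"

definition sigma_plus :: "complex mat" where
  "sigma_plus = mat_adjoint sigma_minus"

definition dA :: "nat \<Rightarrow> real \<Rightarrow> nat \<Rightarrow> complex mat" where
  "dA k lam i = complex_of_real lam \<cdot>\<^sub>m slot k i sigma_minus"

definition dAstar :: "nat \<Rightarrow> real \<Rightarrow> nat \<Rightarrow> complex mat" where
  "dAstar k lam i = complex_of_real lam \<cdot>\<^sub>m slot k i sigma_plus"

definition dLambda :: "nat \<Rightarrow> nat \<Rightarrow> complex mat" where
  "dLambda k i = slot k i (sigma_plus * sigma_minus)"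

definition dt :: "nat \<Rightarrow> real \<Rightarrow> nat \<Rightarrow> complex mat" where
  "dt k lam i = complex_of_real (lam\<^sup>2) \<cdot>\<^sub>m 1\<^sub>m (fulldim k)"

definition interaction ::
  "nat \<Rightarrow> real \<Rightarrow> complex mat \<Rightarrow> complex mat \<Rightarrow> complex mat \<Rightarrow> nat \<Rightarrow> complex mat" where
  "interaction k lam L1 L2 L3 l = mat_exp ((- \<i>) \<cdot>\<^sub>m
     (sys k L1 * dLambda k l + sys k L2 * dAstar k lam l
      + sys k (mat_adjoint L2) * dA k lam l + sys k L3 * dt k lam l))"

primrec evolution ::
  "nat \<Rightarrow> real \<Rightarrow> complex mat \<Rightarrow> complex mat \<Rightarrow> complex mat \<Rightarrow> nat \<Rightarrow> complex mat" where
  "evolution k lam L1 L2 L3 0 = 1\<^sub>m (fulldim k)"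
| "evolution k lam L1 L2 L3 (Suc l) =
     interaction k lam L1 L2 L3 (Suc l) * evolution k lam L1 L2 L3 l"

primrec change_op ::
  "nat \<Rightarrow> real \<Rightarrow> complex mat \<Rightarrow> complex mat \<Rightarrow> nat \<Rightarrow> complex mat" where
  "change_op k lam Mp Mo 0 = 1\<^sub>m (fulldim k)"
| "change_op k lam Mp Mo (Suc l) = change_op k lam Mp Mo l +
     (sys k Mp * (dA k lam (Suc l) + dAstar k lam (Suc l)) + sys k Mo * dt k lam (Suc l))
       * change_op k lam Mp Mo l"

definition heisenberg :: "complex mat \<Rightarrow> complex mat \<Rightarrow> complex mat" where
  "heisenberg W X = mat_adjoint W * X * W"

definition lindblad :: "real \<Rightarrow> complex mat \<Rightarrow> complex mat \<Rightarrow> complex mat \<Rightarrow> complex mat" where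
  "lindblad lam Mp Mo X =
     mat_adjoint Mp * X * Mp + complex_of_real (lam\<^sup>2) \<cdot>\<^sub>m (mat_adjoint Mo * X * Mo)
     + mat_adjoint Mo * X + X * Mo"

definition jump :: "real \<Rightarrow> complex mat \<Rightarrow> complex mat \<Rightarrow> complex mat \<Rightarrow> complex mat" where
  "jump lam Mp Mo X =
     X * Mp + mat_adjoint Mp * X + complex_of_real (lam\<^sup>2) \<cdot>\<^sub>m (mat_adjoint Mo * X * Mp)
     + complex_of_real (lam\<^sup>2) \<cdot>\<^sub>m (mat_adjoint Mp * X * Mo)"

end

theory Submission
  imports Defs
begin

text \<open>The field is diagonalised by the measurement records. For a sequence of outcomes
  \<open>\<plusminus>1\<close> of the quadratures in slots \<open>1, \<dots>, l\<close>, let \<open>p\<close> be the joint spectral projection and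
  \<open>K\<close> the product of the matrices \<open>1 + \<lambda>\<^sup>2 Mo \<plusminus> \<lambda> Mp\<close>. Then \<open>V l * p = (K \<otimes> 1) * p\<close>, while \<open>U l\<close>
  and \<open>V l\<close> agree on vectors of the form \<open>\<psi> \<otimes> \<Phi> \<otimes> \<cdots> \<otimes> \<Phi>\<close> because \<open>\<sigma>\<^sub>-\<close> annihilates \<open>\<Phi>\<close>. As \<open>p\<close>
  has vacuum expectation \<open>1 / 2 ^ l\<close>, both conditional expectations are diagonal in the
  projections, with coefficient \<open>\<rho> (K\<^sup>* X K)\<close> in the unnormalized case and
  \<open>\<rho> (K\<^sup>* X K) / \<rho> (K\<^sup>* K)\<close> in the normalized one. The filtering equation is the expansion of
  \<open>(1 + \<lambda>\<^sup>2 Mo \<plusminus> \<lambda> Mp)\<^sup>* X (1 + \<lambda>\<^sup>2 Mo \<plusminus> \<lambda> Mp)\<close>.\<close>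

subsection \<open>Matrices and Kronecker products\<close>

text \<open>In general \<open>U l\<close> does not commute with the quadratures, so it cannot be
  evaluated record by record. The terms of the interaction with coefficients \<open>Mpm\<close> and
  \<open>Mm\<close> contain \<open>sigma_minus\<close> as rightmost field factor and vanish on the
  vacuum of a slot not yet reached. There \<open>Mm\<close> may be exchanged for \<open>Mp\<close>;
  after this exchange the noise occurs only through the quadrature, which makes the field part of
  \<open>V l\<close> diagonal in the records. The two algebras differ in their null sets. Given the
  noise algebra every record has state value \<open>(1 / 2) ^ l\<close>, so the conditional
  expectation is unique and \<sigma> is determined. After conjugation with \<open>U l\<close> a
  record \<open>bs\<close> has probability \<open>(1 / 2) ^ l * weight bs (1\<^sub>m 2)\<close>,
  which may vanish. There the quotient has denominator zero, versions are not unique, and a version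
  can exist only if the numerator vanishes as well. That it does is the Cauchy-Schwarz property of
  \<rho> in \<open>state_null_left\<close>.\<close>

text \<open>The ring laws are stated with equations between dimensions rather than membership in
  \<open>carrier_mat\<close>, because the simplifier cannot solve side conditions with unknown dimensions.\<close>

lemma mult_assoc_dim:
  "dim_col A = dim_row B \<Longrightarrow> dim_col B = dim_row C \<Longrightarrow> A * B * C = A * (B * C :: complex mat)"
  by (metis assoc_mult_mat carrier_matI)

lemma add_mult_dim:
  "dim_row A = dim_row B \<Longrightarrow> dim_col A = dim_col B \<Longrightarrow> dim_col B = dim_row C \<Longrightarrow>
    (A + B) * C = A * C + B * (C :: complex mat)"
  by (metis add_mult_distrib_mat carrier_matI)

lemma mult_add_dim:
  "dim_row B = dim_row C \<Longrightarrow> dim_col B = dim_col C \<Longrightarrow> dim_col A = dim_row C \<Longrightarrow>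
    A * (B + C) = A * B + A * (C :: complex mat)"
  by (metis mult_add_distrib_mat carrier_matI)

lemma mult_smult_dim:
  "dim_col A = dim_row B \<Longrightarrow> A * (c \<cdot>\<^sub>m B) = c \<cdot>\<^sub>m (A * (B :: complex mat))"
  by (metis mult_smult_distrib carrier_matI)

lemma smult_mult_dim:
  "dim_col A = dim_row B \<Longrightarrow> (c \<cdot>\<^sub>m A) * B = c \<cdot>\<^sub>m (A * (B :: complex mat))"
  by (metis mult_smult_assoc_mat carrier_matI)

lemma smult_add_dim:
  "dim_row A = dim_row B \<Longrightarrow> dim_col A = dim_col B \<Longrightarrow>
    c \<cdot>\<^sub>m (A + B) = c \<cdot>\<^sub>m A + c \<cdot>\<^sub>m (B :: complex mat)"
  by (rule eq_matI) (auto simp: algebra_simps)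

lemma smult_smult_mat: "a \<cdot>\<^sub>m (b \<cdot>\<^sub>m A) = (a * b) \<cdot>\<^sub>m (A :: complex mat)"
  by (rule eq_matI) auto

lemma one_smult_mat: "1 \<cdot>\<^sub>m A = (A :: complex mat)"
  by (rule eq_matI) auto

lemma one_mult_dim: "dim_row A = n \<Longrightarrow> 1\<^sub>m n * A = (A :: complex mat)"
  by (metis left_mult_one_mat carrier_matI)

lemma mult_one_dim: "dim_col A = n \<Longrightarrow> A * 1\<^sub>m n = (A :: complex mat)"
  by (metis right_mult_one_mat carrier_matI)

lemmas mat_ring_dim = mult_assoc_dim add_mult_dim mult_add_dim mult_smult_dim smult_mult_dim
  smult_add_dim smult_smult_mat one_smult_mat one_mult_dim mult_one_dim

lemma mult_square_carrier [simp]: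
  "A \<in> carrier_mat n n \<Longrightarrow> B \<in> carrier_mat n n \<Longrightarrow> A * B \<in> carrier_mat n n"
  by (rule mult_carrier_mat)

lemma dim_mat_adjoint [simp]:
  "dim_row (mat_adjoint A) = dim_col A" "dim_col (mat_adjoint A) = dim_row A"
  by (auto simp: mat_adjoint_def)

lemma index_mat_adjoint [simp]:
  fixes A :: "complex mat"
  shows "i < dim_col A \<Longrightarrow> j < dim_row A \<Longrightarrow> mat_adjoint A $$ (i, j) = cnj (A $$ (j, i))"
  by (simp add: mat_adjoint_def mat_of_rows_index)

lemma carrier_mat_adjoint [simp]: "A \<in> carrier_mat m n \<Longrightarrow> mat_adjoint A \<in> carrier_mat n m"
  by (metis carrier_matD carrier_matI dim_mat_adjoint)

lemma mat_adjoint_adjoint [simp]: "mat_adjoint (mat_adjoint A) = (A :: complex mat)"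
  by (rule eq_matI) auto

lemma mat_adjoint_mult:
  fixes A B :: "complex mat"
  shows "dim_col A = dim_row B \<Longrightarrow> mat_adjoint (A * B) = mat_adjoint B * mat_adjoint A"
  by (rule eq_matI) (auto simp: scalar_prod_def mult.commute intro!: sum.cong)

lemma mat_adjoint_add:
  fixes A B :: "complex mat"
  shows "dim_row A = dim_row B \<Longrightarrow> dim_col A = dim_col B \<Longrightarrow>
    mat_adjoint (A + B) = mat_adjoint A + mat_adjoint B"
  by (rule eq_matI) auto

lemma mat_adjoint_smult:
  fixes A :: "complex mat"
  shows "mat_adjoint (c \<cdot>\<^sub>m A) = cnj c \<cdot>\<^sub>m mat_adjoint A"
  by (rule eq_matI) auto

lemma mat_adjoint_one [simp]: "mat_adjoint (1\<^sub>m n :: complex mat) = 1\<^sub>m n"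
  by (rule eq_matI) auto

lemmas mat_adjoint_simps = mat_adjoint_mult mat_adjoint_add mat_adjoint_smult

section \<open>Kronecker products: mixed product and associativity\<close>

lemma dim_kron [simp]:
  "dim_row (kron A B) = dim_row A * dim_row B" "dim_col (kron A B) = dim_col A * dim_col B"
  by (auto simp: kron_def)

lemma index_kron [simp]:
  "i < dim_row A * dim_row B \<Longrightarrow> j < dim_col A * dim_col B \<Longrightarrow>
    kron A B $$ (i, j)
      = A $$ (i div dim_row B, j div dim_col B) * B $$ (i mod dim_row B, j mod dim_col B)"
  by (auto simp: kron_def)

lemma div_mod_less_prod:
  fixes i m n :: nat
  assumes "i < m * n" shows "i div n < m" "i mod n < n"
  using assms by (auto simp: less_mult_imp_div_less) (metis mod_less_divisor mult_0_right neq0_conv not_less0)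

text \<open>The range is cut into \<open>m\<close> intervals of length \<open>n\<close>, so
  \<open>r\<close> stands for the pair of its quotient and remainder, the two digits of a composite
  index.\<close>

lemma sum_div_mod:
  fixes f :: "nat \<Rightarrow> nat \<Rightarrow> complex"
  shows "(\<Sum>r<m * n. f (r div n) (r mod n)) = (\<Sum>a<m. \<Sum>b<n. f a b)"
proof -
  have "(\<Sum>r<m * n. f (r div n) (r mod n)) = (\<Sum>a<m. \<Sum>r=a*n..<a*n+n. f (r div n) (r mod n))"
    by (simp add: sum.nat_group)
  also have "\<dots> = (\<Sum>a<m. \<Sum>b<n. f a b)"
  proof (rule sum.cong[OF refl])
    fix a
    have "(\<Sum>r=a*n..<a*n+n. f (r div n) (r mod n)) = (\<Sum>b=0..<n. f ((b + a*n) div n) ((b + a*n) mod n))"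
      using sum.shift_bounds_nat_ivl[of "\<lambda>r. f (r div n) (r mod n)" 0 "a*n" n]
      by (simp add: add.commute)
    also have "\<dots> = (\<Sum>b<n. f a b)"
      by (intro sum.cong) auto
    finally show "(\<Sum>r=a*n..<a*n+n. f (r div n) (r mod n)) = (\<Sum>b<n. f a b)" .
  qed
  finally show ?thesis .
qed

text \<open>The summation index splits into two digits and the summand factors accordingly. This
  mixed-product rule is behind every commutation relation between different slots.\<close>

lemma kron_mult:
  assumes "dim_col A = dim_row C" "dim_col B = dim_row D"
  shows "kron A B * kron C D = kron (A * C) (B * D)"
proof (rule eq_matI)
  fix i j assume ij: "i < dim_row (kron (A * C) (B * D))" "j < dim_col (kron (A * C) (B * D))"
  then have i: "i < dim_row A * dim_row B" and j: "j < dim_col C * dim_col D" by auto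
  note i' = div_mod_less_prod[OF i] and j' = div_mod_less_prod[OF j]
  let ?a = "\<lambda>r. A $$ (i div dim_row B, r) * C $$ (r, j div dim_col D)"
  let ?b = "\<lambda>r. B $$ (i mod dim_row B, r) * D $$ (r, j mod dim_col D)"
  have "(kron A B * kron C D) $$ (i, j) = (\<Sum>r<dim_row C * dim_row D. ?a (r div dim_row D) * ?b (r mod dim_row D))"
    using i j assms by (auto simp: scalar_prod_def atLeast0LessThan intro!: sum.cong)
  also have "\<dots> = (\<Sum>a<dim_row C. \<Sum>b<dim_row D. ?a a * ?b b)"
    by (rule sum_div_mod)
  also have "\<dots> = kron (A * C) (B * D) $$ (i, j)"
    using i j i' j' assms by (simp add: scalar_prod_def atLeast0LessThan sum_product)
  finally show "(kron A B * kron C D) $$ (i, j) = kron (A * C) (B * D) $$ (i, j)" .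
qed (use assms in auto)

lemma kron_assoc: "kron (kron A B) C = kron A (kron B C)"
proof (rule eq_matI)
  fix i j assume "i < dim_row (kron A (kron B C))" "j < dim_col (kron A (kron B C))"
  then have i: "i < dim_row A * dim_row B * dim_row C" and j: "j < dim_col A * dim_col B * dim_col C"
    by (auto simp: mult.assoc)
  note i' = div_mod_less_prod[OF i] and j' = div_mod_less_prod[OF j]
  \<comment> \<open>The middle and the last of three digits of an index: dropping the first digit
    before or after the last one makes no difference.\<close>
  have mm: "x mod (p * q) div q = x div q mod p" "x mod (p * q) mod q = x mod q" for x p q :: nat
    by (cases "q = 0"; simp add: mod_mult2_eq mult.commute[of p q])+
  have i2: "i < dim_row A * (dim_row B * dim_row C)" and j2: "j < dim_col A * (dim_col B * dim_col C)"
    using i j by (auto simp: mult.assoc)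
  show "kron (kron A B) C $$ (i, j) = kron A (kron B C) $$ (i, j)"
    using i j i' j' div_mod_less_prod[OF i2] div_mod_less_prod[OF j2] i2 j2
    by (simp add: mm div_mult2_eq mult.commute[of "dim_row B"] mult.commute[of "dim_col B"])
       (simp add: mm mult.commute[of "dim_row C"] mult.commute[of "dim_col C"])
qed (auto simp: mult.assoc)

lemma kron_one: "kron (1\<^sub>m m) (1\<^sub>m n) = 1\<^sub>m (m * n)"
proof (rule eq_matI)
  fix i j assume "i < dim_row (1\<^sub>m (m * n) :: complex mat)" "j < dim_col (1\<^sub>m (m * n) :: complex mat)"
  then have i: "i < m * n" and j: "j < m * n" by auto
  note i' = div_mod_less_prod[OF i] and j' = div_mod_less_prod[OF j]
  have "i = j \<longleftrightarrow> i div n = j div n \<and> i mod n = j mod n"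
    by (metis div_mult_mod_eq)
  then show "kron (1\<^sub>m m) (1\<^sub>m n) $$ (i, j) = 1\<^sub>m (m * n) $$ (i, j)"
    using i j i' j' by auto
qed auto

lemma kron_adjoint: "mat_adjoint (kron A B) = kron (mat_adjoint A) (mat_adjoint B)"
  by (rule eq_matI) (auto simp: div_mod_less_prod)

lemma kron_add_left:
  "dim_row A = dim_row B \<Longrightarrow> dim_col A = dim_col B \<Longrightarrow> kron (A + B) C = kron A C + kron B C"
  by (rule eq_matI) (auto simp: div_mod_less_prod algebra_simps)

lemma kron_add_right:
  "dim_row A = dim_row B \<Longrightarrow> dim_col A = dim_col B \<Longrightarrow> kron C (A + B) = kron C A + kron C B"
  by (rule eq_matI) (auto simp: div_mod_less_prod distrib_left)

lemma kron_smult_left: "kron (c \<cdot>\<^sub>m A) B = c \<cdot>\<^sub>m kron A B"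
  by (rule eq_matI) (auto simp: div_mod_less_prod)

lemma kron_smult_right: "kron A (c \<cdot>\<^sub>m B) = c \<cdot>\<^sub>m kron A B"
  by (rule eq_matI) (auto simp: div_mod_less_prod)

section \<open>Operators acting on one tensor factor\<close>

lemma two_power_split: "i \<le> k \<Longrightarrow> 2 ^ i * 2 * 2 ^ (k - i) = (2 * 2 ^ k :: nat)"
  by (simp add: mult.commute mult.left_commute flip: power_add)

lemma dim_slot [simp]:
  assumes "A \<in> M2" "i \<le> k"
  shows "dim_row (slot k i A) = 2 * 2 ^ k" "dim_col (slot k i A) = 2 * 2 ^ k"
  using assms by (auto simp: slot_def two_power_split)

lemma slot_mult:
  "A \<in> M2 \<Longrightarrow> B \<in> M2 \<Longrightarrow> slot k i (A * B) = slot k i A * slot k i B"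
  unfolding slot_def by (subst kron_mult, force, force)+ simp

lemma slot_add: "A \<in> M2 \<Longrightarrow> B \<in> M2 \<Longrightarrow> slot k i (A + B) = slot k i A + slot k i B"
  by (simp add: slot_def kron_add_left kron_add_right)

lemma slot_smult: "slot k i (c \<cdot>\<^sub>m A) = c \<cdot>\<^sub>m slot k i A"
  unfolding slot_def by (simp add: kron_smult_left kron_smult_right)

lemma slot_adjoint: "mat_adjoint (slot k i A) = slot k i (mat_adjoint A)"
  unfolding slot_def by (simp add: kron_adjoint)

lemma slot_one: "i \<le> k \<Longrightarrow> slot k i (1\<^sub>m 2) = 1\<^sub>m (2 * 2 ^ k)"
  unfolding slot_def by (simp add: kron_one two_power_split)

text \<open>Cutting the tensor product directly after slot \<open>i\<close> turns the two operators
  into \<open>A' \<otimes> 1\<close> and \<open>1 \<otimes> B'\<close>, which commute by the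
  mixed-product rule. The equations \<open>d\<close> and \<open>e\<close> factor the dimensions so
  that the cut becomes visible.\<close>

lemma slot_commute:
  assumes A: "A \<in> M2" and B: "B \<in> M2" and ij: "i < j" "j \<le> k"
  shows "slot k i A * slot k j B = slot k j B * slot k i A"
proof -
  have d: "2 ^ j = 2 ^ i * 2 * (2::nat) ^ (j - Suc i)"
  proof -
    have "j = i + 1 + (j - Suc i)" using ij by simp
    then show ?thesis by (metis power_add power_one_right)
  qed
  have e: "2 ^ (k - i) = (2::nat) ^ (j - Suc i) * 2 * 2 ^ (k - j)"
  proof -
    have "k - i = (j - Suc i) + 1 + (k - j)" using ij by simp
    then show ?thesis by (metis power_add power_one_right)
  qed
  have 1: "slot k i A = kron (kron (1\<^sub>m (2 ^ i)) A) (1\<^sub>m (2 ^ (j - Suc i) * 2 * 2 ^ (k - j)))"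
    unfolding slot_def e ..
  have 2: "slot k j B = kron (1\<^sub>m (2 ^ i * 2)) (kron (kron (1\<^sub>m (2 ^ (j - Suc i))) B) (1\<^sub>m (2 ^ (k - j))))"
    unfolding slot_def d kron_one[symmetric, of "2 ^ i * 2" "2 ^ (j - Suc i)"] kron_assoc ..
  show ?thesis
    unfolding 1 2 using A B by (subst kron_mult, force, force)+ (simp add: one_mult_dim mult_one_dim)
qed

lemma slot_commute':
  assumes "A \<in> M2" "B \<in> M2" "i \<noteq> j" "i \<le> k" "j \<le> k"
  shows "slot k i A * slot k j B = slot k j B * slot k i A"
  using slot_commute[OF assms(1,2), of i j k] slot_commute[OF assms(2,1), of j i k] assms
  by (cases "i < j") auto

subsection \<open>Compression to the vacuum\<close>

text \<open>\<open>vac_embed k\<close> is the isometry \<open>\<psi> \<mapsto> \<psi> \<otimes> \<Phi> \<otimes> \<cdots> \<otimes> \<Phi>\<close>. As \<open>\<Phi>\<close> is the second basis vector, its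
  columns are the basis vectors whose index has last \<open>k\<close> binary digits equal to 1.\<close>

definition last_index :: "nat \<Rightarrow> nat \<Rightarrow> nat" where
  "last_index k j = j * 2 ^ k + (2 ^ k - 1)"

definition vac_embed :: "nat \<Rightarrow> complex mat" where
  "vac_embed k = mat (2 * 2 ^ k) 2 (\<lambda>(a, j). if a = last_index k j then 1 else 0)"

lemma dim_vac_embed [simp]: "dim_row (vac_embed k) = 2 * 2 ^ k" "dim_col (vac_embed k) = 2"
  by (auto simp: vac_embed_def)

lemma last_index_less [simp]: "j < 2 \<Longrightarrow> last_index k j < 2 * 2 ^ k"
proof -
  assume "j < 2"
  then have "j * 2 ^ k \<le> 1 * 2 ^ k" by (intro mult_right_mono) auto
  moreover have "(0::nat) < 2 ^ k" by simp
  ultimately show ?thesis unfolding last_index_def by linarith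
qed

lemma last_index_div_mod [simp]:
  "last_index k j div 2 ^ k = j" "last_index k j mod 2 ^ k = 2 ^ k - 1"
proof -
  have "(q + j * m) div m = j" "(q + j * m) mod m = q" if "q < m" for q m :: nat
    using that by auto
  from this[of "2 ^ k - 1" "2 ^ k"]
  show "last_index k j div 2 ^ k = j" "last_index k j mod 2 ^ k = 2 ^ k - 1"
    by (simp_all only: last_index_def add.commute) simp_all
qed

lemma eq_last_index_iff: "a = last_index k j \<longleftrightarrow> a div 2 ^ k = j \<and> a mod 2 ^ k = 2 ^ k - 1"
  by (metis last_index_div_mod div_mult_mod_eq)

lemma index_vac_embed [simp]:
  "a < 2 * 2 ^ k \<Longrightarrow> j < 2 \<Longrightarrow> vac_embed k $$ (a, j) = (if a = last_index k j then 1 else 0)"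
  by (simp add: vac_embed_def)

lemma mult_vac_embed_index:
  "dim_col Z = 2 * 2 ^ k \<Longrightarrow> i < dim_row Z \<Longrightarrow> j < 2 \<Longrightarrow>
    (Z * vac_embed k) $$ (i, j) = Z $$ (i, last_index k j)"
  by (simp add: scalar_prod_def if_distrib[where f = "\<lambda>x. _ * x"] cong: if_cong)

text \<open>Compression by an isometry whose columns are basis vectors selects a submatrix. In this
  form it can be compared entry by entry with the recursive definition of the product state.\<close>

lemma compress_vac_embed:
  assumes "Z \<in> carrier_mat (2 * 2 ^ k) (2 * 2 ^ k)"
  shows "mat_adjoint (vac_embed k) * (Z * vac_embed k)
    = mat 2 2 (\<lambda>(i, j). Z $$ (last_index k i, last_index k j))"
proof (rule eq_matI)
  fix i j assume "i < dim_row (mat 2 2 (\<lambda>(i, j). Z $$ (last_index k i, last_index k j)))"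
    "j < dim_col (mat 2 2 (\<lambda>(i, j). Z $$ (last_index k i, last_index k j)))"
  then have ij: "i < 2" "j < 2" by auto
  have "(mat_adjoint (vac_embed k) * (Z * vac_embed k)) $$ (i, j)
      = (\<Sum>r<2 * 2 ^ k. cnj (vac_embed k $$ (r, i)) * (Z * vac_embed k) $$ (r, j))"
    using ij assms by (auto simp: scalar_prod_def atLeast0LessThan intro!: sum.cong)
  also have "\<dots> = (\<Sum>r<2 * 2 ^ k. if r = last_index k i then Z $$ (r, last_index k j) else 0)"
    using ij assms by (intro sum.cong) (auto simp: mult_vac_embed_index simp del: index_mult_mat)
  also have "\<dots> = Z $$ (last_index k i, last_index k j)"
    using ij by simp
  finally show "(mat_adjoint (vac_embed k) * (Z * vac_embed k)) $$ (i, j)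
    = mat 2 2 (\<lambda>(i, j). Z $$ (last_index k i, last_index k j)) $$ (i, j)"
    using ij by simp
qed auto

lemma last_index_inj: "last_index k i = last_index k j \<longleftrightarrow> i = j"
  by (metis last_index_div_mod(1))

lemma vac_embed_isometry: "mat_adjoint (vac_embed k) * vac_embed k = 1\<^sub>m 2"
proof -
  have "mat_adjoint (vac_embed k) * (1\<^sub>m (2 * 2 ^ k) * vac_embed k) = 1\<^sub>m 2"
    by (subst compress_vac_embed) (auto simp: last_index_inj intro!: eq_matI)
  then show ?thesis by (simp add: one_mult_dim)
qed

text \<open>An index is read as three blocks of binary digits: those before slot \<open>i\<close>,
  the digit of slot \<open>i\<close>, and those after it. The outer blocks carry identity matrices
  and must agree.\<close>

lemma slot_index:
  assumes A: "A \<in> M2" and i: "i \<le> k" and ab: "a < 2 * 2 ^ k" "b < 2 * 2 ^ k"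
  shows "slot k i A $$ (a, b) = (if a div 2 ^ (k - i) div 2 = b div 2 ^ (k - i) div 2
      \<and> a mod 2 ^ (k - i) = b mod 2 ^ (k - i)
    then A $$ (a div 2 ^ (k - i) mod 2, b div 2 ^ (k - i) mod 2) else 0)"
proof -
  have lt: "a < (2 ^ i * 2) * 2 ^ (k - i)" "b < (2 ^ i * 2) * 2 ^ (k - i)"
    using ab i by (auto simp: two_power_split)
  note l1 = div_mod_less_prod[OF lt(1)] div_mod_less_prod[OF lt(2)]
  show ?thesis
    using lt l1 A div_mod_less_prod[OF l1(1)] div_mod_less_prod[OF l1(3)] by (simp add: slot_def)
qed

text \<open>Both sides send \<psi> to \<open>X \<psi>\<close> tensored with vacuum vectors. By this
  intertwining relation system operators can leave a vacuum compression.\<close>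

lemma sys_vac_embed:
  assumes X: "X \<in> M2"
  shows "sys k X * vac_embed k = vac_embed k * X"
proof (rule eq_matI)
  fix a j assume "a < dim_row (vac_embed k * X)" "j < dim_col (vac_embed k * X)"
  then have aj: "a < 2 * 2 ^ k" "j < 2" using X by auto
  have a2: "a div 2 ^ k < 2" using aj by (simp add: less_mult_imp_div_less)
  have "(vac_embed k * X) $$ (a, j) = (\<Sum>r<2. vac_embed k $$ (a, r) * X $$ (r, j))"
    using aj X by (simp add: scalar_prod_def atLeast0LessThan)
  also have "\<dots> = (\<Sum>r<2. if r = a div 2 ^ k then (if a mod 2 ^ k = 2 ^ k - 1 then X $$ (r, j) else 0) else 0)"
    using aj by (intro sum.cong) (auto simp: eq_last_index_iff)
  also have "\<dots> = (if a mod 2 ^ k = 2 ^ k - 1 then X $$ (a div 2 ^ k, j) else 0)"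
    using a2 by simp
  also have "\<dots> = sys k X $$ (a, last_index k j)"
    using aj a2 X by (subst slot_index) auto
  also have "\<dots> = (sys k X * vac_embed k) $$ (a, j)"
    using aj X by (subst mult_vac_embed_index) auto
  finally show "(sys k X * vac_embed k) $$ (a, j) = (vac_embed k * X) $$ (a, j)" ..
qed (use X in auto)

text \<open>The projection onto \<open>vac_vec\<close>. Placed in any field slot it fixes
  \<open>vac_embed k\<close>, so it may be inserted freely next to it.\<close>

definition vac_proj :: "complex mat" where
  "vac_proj = mat 2 2 (\<lambda>(i, j). if i = 1 \<and> j = 1 then 1 else 0)"

lemma vac_proj_carrier [simp]: "vac_proj \<in> M2"
  by (simp add: vac_proj_def)

text \<open>The binary digits of \<open>last_index k j\<close> are \<open>j\<close> followed by
  \<open>k\<close> ones, and \<open>2 ^ (k - i)\<close> is the place value of slot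
  \<open>i\<close>.\<close>

lemma last_index_bit:
  assumes "1 \<le> i" "i \<le> k"
  shows "last_index k j div 2 ^ (k - i) mod 2 = 1"
proof -
  have k: "(2::nat) ^ k = 2 ^ (k - i) * 2 ^ i" using assms by (simp flip: power_add)
  have i: "(2::nat) ^ i = 2 * 2 ^ (i - 1)" using assms by (cases i) auto
  have p: "(0::nat) < 2 ^ i" "(0::nat) < 2 ^ (k - i)" by auto
  \<comment> \<open>The trailing \<open>k - i\<close> ones are split off. Powers are then written as
    successors because subtraction of natural numbers is truncated.\<close>
  have "last_index k j = (2 ^ (k - i) - 1) + (j * 2 ^ i + (2 ^ i - 1)) * 2 ^ (k - i)"
  proof -
    obtain p q where "2 ^ i = Suc p" "2 ^ (k - i) = Suc q"
      using p by (metis gr0_implies_Suc)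
    then show ?thesis unfolding last_index_def k by (simp add: algebra_simps)
  qed
  then have "last_index k j div 2 ^ (k - i) = j * 2 ^ i + (2 ^ i - 1)"
  proof -
    have "(q + c * m) div m = c" if "q < m" for q c m :: nat
      using that by auto
    from this[of "2 ^ (k - i) - 1" "2 ^ (k - i)"] show ?thesis
      using p \<open>last_index k j = _\<close> by simp
  qed
  also have "\<dots> = 1 + 2 * (j * 2 ^ (i - 1) + (2 ^ (i - 1) - 1))"
  proof -
    obtain q where "(2::nat) ^ (i - 1) = Suc q"
      by (metis gr0_implies_Suc zero_less_numeral zero_less_power)
    then show ?thesis unfolding i by simp
  qed
  finally show ?thesis by (simp only: mod_mult_self2) simp
qed

lemma slot_vac_proj_vac_embed:
  assumes i: "1 \<le> i" "i \<le> k"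
  shows "slot k i vac_proj * vac_embed k = vac_embed k"
proof (rule eq_matI)
  fix a j assume "a < dim_row (vac_embed k)" "j < dim_col (vac_embed k)"
  then have aj: "a < 2 * 2 ^ k" "j < 2" by auto
  let ?m = "2 ^ (k - i) :: nat" and ?b = "last_index k j"
  \<comment> \<open>An index is determined by its three digit blocks. In the index \<open>?b\<close>
    the digit of slot \<open>i\<close> is 1, so the restriction to that digit loses nothing.\<close>
  have "a = ?b \<longleftrightarrow> a div ?m = ?b div ?m \<and> a mod ?m = ?b mod ?m"
    by (metis div_mult_mod_eq)
  moreover have "a div ?m = ?b div ?m \<longleftrightarrow> a div ?m div 2 = ?b div ?m div 2 \<and> a div ?m mod 2 = ?b div ?m mod 2"
    by (metis div_mult_mod_eq)
  ultimately show "(slot k i vac_proj * vac_embed k) $$ (a, j) = vac_embed k $$ (a, j)"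
    using aj i by (subst mult_vac_embed_index) (auto simp: slot_index last_index_bit vac_proj_def)
qed (use i in auto)

lemma vac_state_index:
  assumes "X \<in> M2" shows "vac_state X = X $$ (1, 1)"
  using assms by (auto simp: vac_state_def vac_vec_def scalar_prod_def numeral_2_eq_2)

text \<open>Evaluating the last factor in the vacuum picks its entry \<open>(1, 1)\<close> and so
  appends a binary digit 1 to the index:
  \<open>last_index (Suc k) i = last_index k i * 2 + 1\<close>. Iteration leaves exactly the entries
  that the compression selects.\<close>

lemma prod_state_compress:
  assumes "Z \<in> carrier_mat (2 * 2 ^ k) (2 * 2 ^ k)"
  shows "prod_state \<rho> k Z = \<rho> (mat_adjoint (vac_embed k) * (Z * vac_embed k))"
  unfolding compress_vac_embed[OF assms] using assms
proof (induction k arbitrary: Z)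
  case 0
  then show ?case by (auto simp: last_index_def intro!: arg_cong[of _ _ \<rho>] eq_matI)
next
  case (Suc k)
  let ?Z = "mat (2 * 2 ^ k) (2 * 2 ^ k) (\<lambda>(i, j). vac_state (mat 2 2 (\<lambda>(a, b). Z $$ (i * 2 + a, j * 2 + b))))"
  have "last_index k i * 2 + 1 = last_index (Suc k) i" for i
  proof -
    obtain p where "(2::nat) ^ k = Suc p"
      by (metis gr0_implies_Suc zero_less_numeral zero_less_power)
    then show ?thesis by (simp add: last_index_def)
  qed
  then have "mat 2 2 (\<lambda>(i, j). ?Z $$ (last_index k i, last_index k j))
    = mat 2 2 (\<lambda>(i, j). Z $$ (last_index (Suc k) i, last_index (Suc k) j))"
    by (auto simp: vac_state_index intro!: eq_matI)
  then show ?case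
    using Suc.IH[of ?Z] by (simp add: tensor_functional_def)
qed

subsection \<open>The matrix exponential and null vectors of states\<close>

lemma suminf_cnj: "summable f \<Longrightarrow> cnj (\<Sum>m. f m) = (\<Sum>m. cnj (f m))"
  by (rule bounded_linear.suminf[OF bounded_linear_cnj])

lemma pow_mat_add:
  fixes A :: "complex mat"
  assumes "A \<in> carrier_mat n n"
  shows "A ^\<^sub>m p * A ^\<^sub>m q = A ^\<^sub>m (p + q)"
proof (induction q)
  case 0
  then show ?case using assms by (simp add: mult_one_dim)
next
  case (Suc q)
  have "A ^\<^sub>m p * A ^\<^sub>m Suc q = (A ^\<^sub>m p * A ^\<^sub>m q) * A"
    using assms by (simp add: mult_assoc_dim)
  then show ?case using Suc by simp
qed

lemma pow_mat_smult:
  fixes A :: "complex mat"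
  assumes "A \<in> carrier_mat n n"
  shows "(c \<cdot>\<^sub>m A) ^\<^sub>m m = c ^ m \<cdot>\<^sub>m A ^\<^sub>m m"
  using assms by (induction m) (auto simp: mult_smult_dim smult_mult_dim smult_smult_mat one_smult_mat mult.commute)

lemma pow_mat_adjoint:
  fixes A :: "complex mat"
  assumes "A \<in> carrier_mat n n"
  shows "mat_adjoint (A ^\<^sub>m m) = mat_adjoint A ^\<^sub>m m"
proof (induction m)
  case 0
  then show ?case using assms by simp
next
  case (Suc m)
  have c: "mat_adjoint A \<in> carrier_mat n n" using assms by simp
  have "mat_adjoint (A ^\<^sub>m Suc m) = mat_adjoint A * mat_adjoint A ^\<^sub>m m"
    using assms Suc by (simp add: mat_adjoint_mult)
  also have "\<dots> = mat_adjoint A ^\<^sub>m 1 * mat_adjoint A ^\<^sub>m m"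
    using assms by (simp add: one_mult_dim)
  also have "\<dots> = mat_adjoint A ^\<^sub>m Suc m"
    unfolding pow_mat_add[OF c] by (simp only: plus_1_eq_Suc)
  finally show ?case .
qed

text \<open>Each multiplication sums \<open>n\<close> products, so the growth per factor is at most
  \<open>n * b\<close>. The exponential series is thereby majorised by that of a real
  number.\<close>

lemma pow_mat_entry_bound:
  fixes A :: "complex mat"
  assumes A: "A \<in> carrier_mat n n" and b: "\<And>i j. i < n \<Longrightarrow> j < n \<Longrightarrow> cmod (A $$ (i, j)) \<le> b"
    and ij: "i < n" "j < n"
  shows "cmod ((A ^\<^sub>m m) $$ (i, j)) \<le> (real n * b) ^ m"
  using ij
proof (induction m arbitrary: i j)
  case 0
  then show ?case using A by simp
next
  case (Suc m)
  have "0 \<le> b" using b[OF Suc.prems] norm_ge_zero order_trans by blast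
  have "cmod ((A ^\<^sub>m Suc m) $$ (i, j)) = cmod (\<Sum>r<n. (A ^\<^sub>m m) $$ (i, r) * A $$ (r, j))"
    using A Suc.prems by (simp add: scalar_prod_def atLeast0LessThan)
  also have "\<dots> \<le> (\<Sum>r<n. (real n * b) ^ m * b)"
    using Suc.prems b \<open>0 \<le> b\<close>
    by (intro sum_norm_le) (auto simp: norm_mult intro!: mult_mono Suc.IH)
  also have "\<dots> = (real n * b) ^ Suc m" by simp
  finally show ?case .
qed

lemma summable_mat_exp_norm:
  fixes A :: "complex mat"
  assumes A: "A \<in> carrier_mat n n" and ij: "i < n" "j < n"
  shows "summable (\<lambda>m. norm ((A ^\<^sub>m m) $$ (i, j) / fact m))"
proof -
  define b where "b = (\<Sum>i<n. \<Sum>j<n. cmod (A $$ (i, j)))"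
  have b: "cmod (A $$ (i, j)) \<le> b" if "i < n" "j < n" for i j
  proof -
    have "cmod (A $$ (i, j)) \<le> (\<Sum>j<n. cmod (A $$ (i, j)))"
      using that by (intro member_le_sum) auto
    also have "\<dots> \<le> b"
      unfolding b_def using that by (intro member_le_sum[where f = "\<lambda>i. \<Sum>j<n. cmod (A $$ (i, j))"]) (auto intro: sum_nonneg)
    finally show ?thesis .
  qed
  show ?thesis
  proof (rule summable_comparison_test')
    show "summable (\<lambda>m. inverse (fact m) * (real n * b) ^ m)" by (rule summable_exp)
    show "norm (norm ((A ^\<^sub>m m) $$ (i, j) / fact m)) \<le> inverse (fact m) * (real n * b) ^ m" for m
      using pow_mat_entry_bound[OF A b ij, of m]
      by (simp add: norm_divide field_simps)
  qed
qed

lemma summable_mat_exp: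
  fixes A :: "complex mat"
  assumes "A \<in> carrier_mat n n" "i < n" "j < n"
  shows "summable (\<lambda>m. (A ^\<^sub>m m) $$ (i, j) / fact m)"
  by (rule summable_norm_cancel[OF summable_mat_exp_norm[OF assms]])

lemma mat_exp_carrier [simp]: "A \<in> carrier_mat n n \<Longrightarrow> mat_exp A \<in> carrier_mat n n"
  by (auto simp: mat_exp_def)

lemma mat_exp_adjoint:
  assumes A: "A \<in> carrier_mat n n"
  shows "mat_adjoint (mat_exp A) = mat_exp (mat_adjoint A)"
proof (rule eq_matI)
  fix i j assume "i < dim_row (mat_exp (mat_adjoint A))" "j < dim_col (mat_exp (mat_adjoint A))"
  then have ij: "i < n" "j < n" using A by (auto simp: mat_exp_def)
  have "mat_adjoint (mat_exp A) $$ (i, j) = (\<Sum>m. cnj ((A ^\<^sub>m m) $$ (j, i) / fact m))"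
    using A ij by (simp add: mat_exp_def suminf_cnj[OF summable_mat_exp[OF A]])
  also have "\<dots> = (\<Sum>m. (mat_adjoint A ^\<^sub>m m) $$ (i, j) / fact m)"
    using A ij by (simp flip: pow_mat_adjoint[OF A])
  also have "\<dots> = mat_exp (mat_adjoint A) $$ (i, j)"
    using A ij by (simp add: mat_exp_def)
  finally show "mat_adjoint (mat_exp A) $$ (i, j) = mat_exp (mat_adjoint A) $$ (i, j)" .
qed (use A in \<open>auto simp: mat_exp_def\<close>)

text \<open>The coefficient of degree \<open>m\<close> in the product of the series for
  \<open>exp 1\<close> and \<open>exp (-1)\<close>, which is
  \<open>(1 - 1) ^ m / fact m\<close>.\<close>

lemma sum_alternating_fact:
  "(\<Sum>p\<le>m. (-1) ^ (m - p) / (fact p * fact (m - p))) = (if m = 0 then 1 else 0 :: complex)"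
proof -
  have "(\<Sum>p\<le>m. (-1) ^ (m - p) / (fact p * fact (m - p)))
      = (\<Sum>p\<le>m. (1::complex) ^ p /\<^sub>R fact p * ((-1) ^ (m - p) /\<^sub>R fact (m - p)))"
    by (simp add: scaleR_conv_of_real field_simps)
  also have "\<dots> = (1 + (-1 :: complex)) ^ m /\<^sub>R fact m"
    by (rule exp_series_add_commuting[symmetric]) simp
  finally show ?thesis by simp
qed

text \<open>Entries of the product are sums of Cauchy products of absolutely convergent series. In
  degree \<open>m\<close> all terms carry the same power of \<open>A\<close>, leaving an alternating
  sum that vanishes unless \<open>m = 0\<close>.\<close>

lemma mat_exp_minus:
  assumes A: "A \<in> carrier_mat n n"
  shows "mat_exp A * mat_exp ((-1) \<cdot>\<^sub>m A) = 1\<^sub>m n"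
proof (rule eq_matI)
  fix i j assume "i < dim_row (1\<^sub>m n :: complex mat)" "j < dim_col (1\<^sub>m n :: complex mat)"
  then have ij: "i < n" "j < n" by auto
  let ?B = "(-1) \<cdot>\<^sub>m A"
  have B: "?B \<in> carrier_mat n n" using A by simp
  define a where "a = (\<lambda>r p. (A ^\<^sub>m p) $$ (i, r) / fact p)"
  define b where "b = (\<lambda>r p. (?B ^\<^sub>m p) $$ (r, j) / fact p)"
  have sa: "summable (\<lambda>p. norm (a r p))" and sb: "summable (\<lambda>p. norm (b r p))" if "r < n" for r
    unfolding a_def b_def using summable_mat_exp_norm[OF A] summable_mat_exp_norm[OF B] ij that by auto
  have conv: "(\<Sum>r<n. \<Sum>p\<le>m. a r p * b r (m - p)) = (if m = 0 then 1\<^sub>m n $$ (i, j) else 0)" for m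
  proof -
    have "(\<Sum>r<n. \<Sum>p\<le>m. a r p * b r (m - p)) = (\<Sum>p\<le>m. \<Sum>r<n. a r p * b r (m - p))"
      by (rule sum.swap)
    also have "\<dots> = (\<Sum>p\<le>m. (A ^\<^sub>m m) $$ (i, j) * ((-1) ^ (m - p) / (fact p * fact (m - p))))"
    proof (rule sum.cong[OF refl])
      fix p assume p: "p \<in> {..m}"
      have "(\<Sum>r<n. a r p * b r (m - p)) = (\<Sum>r<n. (A ^\<^sub>m p) $$ (i, r) * (A ^\<^sub>m (m - p)) $$ (r, j)) * ((-1) ^ (m - p) / (fact p * fact (m - p)))"
        unfolding a_def b_def pow_mat_smult[OF A] sum_distrib_right
        using A ij by (intro sum.cong) auto
      also have "(\<Sum>r<n. (A ^\<^sub>m p) $$ (i, r) * (A ^\<^sub>m (m - p)) $$ (r, j)) = (A ^\<^sub>m p * A ^\<^sub>m (m - p)) $$ (i, j)"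
        using A ij by (simp add: scalar_prod_def atLeast0LessThan)
      also have "A ^\<^sub>m p * A ^\<^sub>m (m - p) = A ^\<^sub>m m"
        using p by (simp add: pow_mat_add[OF A])
      finally show "(\<Sum>r<n. a r p * b r (m - p)) = (A ^\<^sub>m m) $$ (i, j) * ((-1) ^ (m - p) / (fact p * fact (m - p)))" .
    qed
    also have "\<dots> = (A ^\<^sub>m m) $$ (i, j) * (if m = 0 then 1 else 0)"
      unfolding sum_distrib_left[symmetric] sum_alternating_fact ..
    finally show ?thesis using A by auto
  qed
  have "(mat_exp A * mat_exp ?B) $$ (i, j) = (\<Sum>r<n. (\<Sum>p. a r p) * (\<Sum>p. b r p))"
    using A ij by (simp add: mat_exp_def scalar_prod_def atLeast0LessThan a_def b_def)
  also have "\<dots> = (\<Sum>r<n. \<Sum>m. \<Sum>p\<le>m. a r p * b r (m - p))"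
    by (intro sum.cong refl Cauchy_product sa sb) auto
  also have "\<dots> = (\<Sum>m. \<Sum>r<n. \<Sum>p\<le>m. a r p * b r (m - p))"
    by (rule suminf_sum[symmetric]) (auto intro!: summable_Cauchy_product sa sb)
  also have "\<dots> = 1\<^sub>m n $$ (i, j)"
    unfolding conv using suminf_finite[of "{0::nat}" "\<lambda>m. if m = 0 then 1\<^sub>m n $$ (i, j) else (0::complex)"] by simp
  finally show "(mat_exp A * mat_exp ?B) $$ (i, j) = 1\<^sub>m n $$ (i, j)" .
qed (use A in \<open>auto simp: mat_exp_def\<close>)

lemma mat_exp_unitary:
  assumes A: "A \<in> carrier_mat n n" and skew: "mat_adjoint A = (-1) \<cdot>\<^sub>m A"
  shows "mat_adjoint (mat_exp A) * mat_exp A = 1\<^sub>m n" "mat_exp A * mat_adjoint (mat_exp A) = 1\<^sub>m n"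
proof -
  have "(-1) \<cdot>\<^sub>m ((-1) \<cdot>\<^sub>m A) = A" by (simp add: smult_smult_mat one_smult_mat)
  then show "mat_adjoint (mat_exp A) * mat_exp A = 1\<^sub>m n" "mat_exp A * mat_adjoint (mat_exp A) = 1\<^sub>m n"
    using mat_exp_minus[OF A] mat_exp_minus[of "(-1) \<cdot>\<^sub>m A" n] A
    by (simp_all add: mat_exp_adjoint[OF A] skew)
qed

text \<open>Expand \<open>0 \<le> f ((B\<^sup>* + t A)\<^sup>* (B\<^sup>* + t A))\<close> and let \<open>t\<close> run through the real and the
  imaginary axis.\<close>

lemma state_null_left:
  assumes f: "is_state n f" and A: "A \<in> carrier_mat n n" and B: "B \<in> carrier_mat n n"
    and null: "f (mat_adjoint A * A) = 0"
  shows "f (B * A) = 0"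
proof -
  let ?D = "mat_adjoint B"
  have add: "X \<in> carrier_mat n n \<Longrightarrow> Y \<in> carrier_mat n n \<Longrightarrow> f (X + Y) = f X + f Y"
    and sm: "X \<in> carrier_mat n n \<Longrightarrow> f (c \<cdot>\<^sub>m X) = c * f X"
    and pos: "X \<in> carrier_mat n n \<Longrightarrow> 0 \<le> f (mat_adjoint X * X)" for X Y c
    using f unfolding is_state_def by auto
  have exp: "f (mat_adjoint (?D + t \<cdot>\<^sub>m A) * (?D + t \<cdot>\<^sub>m A))
      = f (B * ?D) + t * f (B * A) + cnj t * f (mat_adjoint A * ?D)" for t
  proof -
    have "mat_adjoint (?D + t \<cdot>\<^sub>m A) * (?D + t \<cdot>\<^sub>m A)
        = B * ?D + t \<cdot>\<^sub>m (B * A) + (cnj t \<cdot>\<^sub>m (mat_adjoint A * ?D) + (cnj t * t) \<cdot>\<^sub>m (mat_adjoint A * A))"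
      using A B by (simp add: mat_adjoint_simps mat_ring_dim)
        (rule eq_matI; simp add: algebra_simps del: index_mult_mat(1))
    then show ?thesis using A B null by (simp add: add sm)
  qed
  have pos': "0 \<le> f (B * ?D) + t * f (B * A) + cnj t * f (mat_adjoint A * ?D)" for t
    unfolding exp[symmetric] using A B by (intro pos) auto
  define a z w where "a = f (B * ?D)" and "z = f (B * A)" and "w = f (mat_adjoint A * ?D)"
  have re: "x = 0" if "\<And>r :: real. 0 \<le> s + r * x" for x s :: real
  proof (rule ccontr)
    assume "x \<noteq> 0"
    \<comment> \<open>At this argument the affine function has the value -1.\<close>
    then show False using that[of "- (s + 1) / x"] by simp
  qed
  have line: "u = 0" if "\<And>r :: real. 0 \<le> a + of_real r * u" for u
  proof -
    have "Re u = 0" using that by (intro re[of "Re a"]) (simp add: less_eq_complex_def)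
    \<comment> \<open>The order on the complex numbers makes every value real, so
      \<open>r = 0\<close> and \<open>r = 1\<close> together determine the imaginary part.\<close>
    moreover have "Im u = 0" using that[of 0] that[of 1] by (simp add: less_eq_complex_def)
    ultimately show ?thesis by (simp add: complex_eq_iff)
  qed
  have "z + w = 0"
    by (rule line) (use pos'[folded a_def z_def w_def, of "of_real _"] in \<open>simp add: algebra_simps\<close>)
  moreover have "\<i> * (z - w) = 0"
    by (rule line) (use pos'[folded a_def z_def w_def, of "of_real _ * \<i>"] in \<open>simp add: algebra_simps\<close>)
  ultimately show ?thesis unfolding z_def[symmetric] by (auto simp: complex_eq_iff)
qed

subsection \<open>Commutative algebras spanned by orthogonal projections\<close>

text \<open>The type \<open>complex mat\<close> contains matrices of all dimensions and has no
  single zero, hence the sum is formed entrywise with an explicit dimension.\<close>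

definition lin_comb ::
  "nat \<Rightarrow> 'i set \<Rightarrow> ('i \<Rightarrow> complex) \<Rightarrow> ('i \<Rightarrow> complex mat) \<Rightarrow> complex mat" where
  "lin_comb n I c p = mat n n (\<lambda>(a, b). \<Sum>i\<in>I. c i * p i $$ (a, b))"

lemma lin_comb_carrier [simp]: "lin_comb n I c p \<in> carrier_mat n n"
  by (simp add: lin_comb_def)

lemma dim_lin_comb [simp]: "dim_row (lin_comb n I c p) = n" "dim_col (lin_comb n I c p) = n"
  by (simp_all add: lin_comb_def)

lemma lin_comb_cong:
  "(\<And>i. i \<in> I \<Longrightarrow> c i = d i) \<Longrightarrow> (\<And>i. i \<in> I \<Longrightarrow> p i = q i) \<Longrightarrow> lin_comb n I c p = lin_comb n I d q"
  by (auto simp: lin_comb_def intro!: eq_matI sum.cong)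

lemma lin_comb_empty: "lin_comb n {} c p = 0\<^sub>m n n"
  by (auto simp: lin_comb_def intro!: eq_matI)

lemma lin_comb_insert:
  "finite I \<Longrightarrow> i \<notin> I \<Longrightarrow> p i \<in> carrier_mat n n \<Longrightarrow>
    lin_comb n (insert i I) c p = c i \<cdot>\<^sub>m p i + lin_comb n I c p"
  by (auto simp: lin_comb_def intro!: eq_matI)

lemma lin_comb_mult_right:
  assumes B: "B \<in> carrier_mat n n" and p: "\<And>i. i \<in> I \<Longrightarrow> p i \<in> carrier_mat n n"
  shows "lin_comb n I c p * B = lin_comb n I c (\<lambda>i. p i * B)"
proof (rule eq_matI)
  fix a b assume "a < dim_row (lin_comb n I c (\<lambda>i. p i * B))" "b < dim_col (lin_comb n I c (\<lambda>i. p i * B))"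
  then have ab: "a < n" "b < n" by auto
  have "(lin_comb n I c p * B) $$ (a, b) = (\<Sum>r<n. \<Sum>i\<in>I. c i * p i $$ (a, r) * B $$ (r, b))"
    using ab B by (simp add: lin_comb_def scalar_prod_def atLeast0LessThan sum_distrib_right)
  also have "\<dots> = (\<Sum>i\<in>I. \<Sum>r<n. c i * p i $$ (a, r) * B $$ (r, b))"
    by (rule sum.swap)
  also have "\<dots> = (\<Sum>i\<in>I. c i * (p i * B) $$ (a, b))"
    using ab B p
    by (intro sum.cong refl) (simp add: scalar_prod_def atLeast0LessThan sum_distrib_left mult.assoc carrier_matD[OF p])
  also have "\<dots> = lin_comb n I c (\<lambda>i. p i * B) $$ (a, b)"
    using ab by (simp add: lin_comb_def)
  finally show "(lin_comb n I c p * B) $$ (a, b) = lin_comb n I c (\<lambda>i. p i * B) $$ (a, b)" .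
qed (use B in auto)

lemma lin_comb_adjoint:
  assumes p: "\<And>i. i \<in> I \<Longrightarrow> p i \<in> carrier_mat n n"
  shows "mat_adjoint (lin_comb n I c p) = lin_comb n I (\<lambda>i. cnj (c i)) (\<lambda>i. mat_adjoint (p i))"
  by (rule eq_matI) (auto simp: lin_comb_def carrier_matD[OF p] intro!: sum.cong)

text \<open>Adjoints reduce this to multiplication from the right, so the interchange of sums is
  carried out once.\<close>

lemma lin_comb_mult_left:
  assumes B: "B \<in> carrier_mat n n" and p: "\<And>i. i \<in> I \<Longrightarrow> p i \<in> carrier_mat n n"
  shows "B * lin_comb n I c p = lin_comb n I c (\<lambda>i. B * p i)"
proof -
  have "mat_adjoint (B * lin_comb n I c p) = lin_comb n I (\<lambda>i. cnj (c i)) (\<lambda>i. mat_adjoint (p i) * mat_adjoint B)"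
    using B p by (simp add: mat_adjoint_mult lin_comb_adjoint lin_comb_mult_right)
  also have "\<dots> = mat_adjoint (lin_comb n I c (\<lambda>i. B * p i))"
    using B by (subst lin_comb_adjoint) (auto simp: mat_adjoint_mult p carrier_matD[OF p] intro!: lin_comb_cong)
  finally show ?thesis by (metis mat_adjoint_adjoint)
qed

lemma lin_comb_add: "lin_comb n I c p + lin_comb n I d p = lin_comb n I (\<lambda>i. c i + d i) p"
  by (rule eq_matI) (auto simp: lin_comb_def distrib_right sum.distrib)

lemma lin_comb_smult: "a \<cdot>\<^sub>m lin_comb n I c p = lin_comb n I (\<lambda>i. a * c i) p"
  by (rule eq_matI) (auto simp: lin_comb_def sum_distrib_left mult.assoc)

lemma lin_comb_absorb:
  assumes "\<And>i. i \<in> I \<Longrightarrow> p i \<in> carrier_mat n n"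
  shows "lin_comb n I c (\<lambda>i. d i \<cdot>\<^sub>m p i) = lin_comb n I (\<lambda>i. c i * d i) p"
  by (rule eq_matI) (auto simp: lin_comb_def carrier_matD[OF assms] mult.assoc intro!: sum.cong)

text \<open>The linear part of \<open>is_state\<close>. Conditional expectations onto a span of
  projections are computed from it, and it passes from \<rho> to the product state by the
  compression formula.\<close>

definition linear_functional :: "nat \<Rightarrow> (complex mat \<Rightarrow> complex) \<Rightarrow> bool" where
  "linear_functional n f \<longleftrightarrow>
     (\<forall>A \<in> carrier_mat n n. \<forall>B \<in> carrier_mat n n. f (A + B) = f A + f B) \<and>
     (\<forall>c. \<forall>A \<in> carrier_mat n n. f (c \<cdot>\<^sub>m A) = c * f A)"

lemma linear_functional_add:
  "linear_functional n f \<Longrightarrow> A \<in> carrier_mat n n \<Longrightarrow> B \<in> carrier_mat n n \<Longrightarrow> f (A + B) = f A + f B"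
  by (simp add: linear_functional_def)

lemma linear_functional_smult:
  "linear_functional n f \<Longrightarrow> A \<in> carrier_mat n n \<Longrightarrow> f (c \<cdot>\<^sub>m A) = c * f A"
  by (simp add: linear_functional_def)

lemma linear_functional_lin_comb:
  assumes f: "linear_functional n f" and I: "finite I" and p: "\<And>i. i \<in> I \<Longrightarrow> p i \<in> carrier_mat n n"
  shows "f (lin_comb n I c p) = (\<Sum>i\<in>I. c i * f (p i))"
  using I p
proof (induction I rule: finite_induct)
  case empty
  have "f (0 \<cdot>\<^sub>m 0\<^sub>m n n) = 0" using f by (simp add: linear_functional_smult del: smult_zero_mat)
  then show ?case by (simp add: lin_comb_empty)
next
  case (insert i I)
  then show ?case
    by (simp add: lin_comb_insert linear_functional_add[OF f] linear_functional_smult[OF f])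
qed

lemma smult_mat_cancel:
  fixes A :: "complex mat"
  assumes "a \<cdot>\<^sub>m A = b \<cdot>\<^sub>m A" "A \<noteq> 0\<^sub>m n n" "A \<in> carrier_mat n n"
  shows "a = b"
proof (rule ccontr)
  assume ab: "a \<noteq> b"
  have "A $$ (i, j) = 0" if "i < n" "j < n" for i j
  proof -
    have "(a \<cdot>\<^sub>m A) $$ (i, j) = (b \<cdot>\<^sub>m A) $$ (i, j)" using assms by simp
    then show ?thesis using ab assms(3) that by simp
  qed
  then have "A = 0\<^sub>m n n" using assms(3) by (intro eq_matI) auto
  then show False using assms by simp
qed

lemma star_alg_carrier:
  assumes "S \<subseteq> carrier_mat n n"
  shows "star_alg n S \<subseteq> carrier_mat n n"
proof
  fix A assume "A \<in> star_alg n S"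
  then show "A \<in> carrier_mat n n" by induction (use assms in auto)
qed

lemma star_alg_lin_comb:
  assumes I: "finite I" and p: "\<And>i. i \<in> I \<Longrightarrow> p i \<in> star_alg n S \<and> p i \<in> carrier_mat n n"
  shows "lin_comb n I c p \<in> star_alg n S"
  using I p
proof (induction I rule: finite_induct)
  case empty
  have "0 \<cdot>\<^sub>m 1\<^sub>m n \<in> star_alg n S" by (intro star_alg.intros)
  moreover have "0 \<cdot>\<^sub>m 1\<^sub>m n = (0\<^sub>m n n :: complex mat)" by (rule eq_matI) auto
  ultimately show ?case by (simp add: lin_comb_empty)
next
  case (insert i I)
  then show ?case by (auto simp: lin_comb_insert intro: star_alg.intros)
qed

section \<open>Conjugation by a unitary\<close>

lemma heisenberg_carrier [simp]:
  "W \<in> carrier_mat n n \<Longrightarrow> A \<in> carrier_mat n n \<Longrightarrow> heisenberg W A \<in> carrier_mat n n"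
  by (metis carrier_mat_adjoint heisenberg_def mult_carrier_mat)

lemma heisenberg_adjoint:
  "W \<in> carrier_mat n n \<Longrightarrow> A \<in> carrier_mat n n \<Longrightarrow>
    mat_adjoint (heisenberg W A) = heisenberg W (mat_adjoint A)"
  by (simp add: heisenberg_def mat_adjoint_mult mult_assoc_dim)

lemma heisenberg_mult:
  assumes W: "W \<in> carrier_mat n n" "W * mat_adjoint W = 1\<^sub>m n"
    and AB: "A \<in> carrier_mat n n" "B \<in> carrier_mat n n"
  shows "heisenberg W A * heisenberg W B = heisenberg W (A * B)"
proof -
  have "heisenberg W A * heisenberg W B = mat_adjoint W * (A * ((W * mat_adjoint W) * (B * W)))"
    using W(1) AB by (simp add: heisenberg_def mult_assoc_dim)
  also have "\<dots> = heisenberg W (A * B)"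
    unfolding W(2) using W(1) AB by (simp add: heisenberg_def mult_assoc_dim one_mult_dim)
  finally show ?thesis .
qed

lemma heisenberg_add:
  "W \<in> carrier_mat n n \<Longrightarrow> A \<in> carrier_mat n n \<Longrightarrow> B \<in> carrier_mat n n \<Longrightarrow>
    heisenberg W (A + B) = heisenberg W A + heisenberg W B"
  by (simp add: heisenberg_def mat_ring_dim)

lemma heisenberg_smult:
  "W \<in> carrier_mat n n \<Longrightarrow> A \<in> carrier_mat n n \<Longrightarrow>
    heisenberg W (c \<cdot>\<^sub>m A) = c \<cdot>\<^sub>m heisenberg W A"
  by (simp add: heisenberg_def mat_ring_dim)

lemma heisenberg_one:
  "W \<in> carrier_mat n n \<Longrightarrow> mat_adjoint W * W = 1\<^sub>m n \<Longrightarrow> heisenberg W (1\<^sub>m n) = 1\<^sub>m n"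
  by (simp add: heisenberg_def mat_ring_dim)

lemma heisenberg_lin_comb:
  assumes W: "W \<in> carrier_mat n n" and p: "\<And>i. i \<in> I \<Longrightarrow> p i \<in> carrier_mat n n"
  shows "heisenberg W (lin_comb n I c p) = lin_comb n I c (\<lambda>i. heisenberg W (p i))"
proof -
  have "mat_adjoint W * lin_comb n I c p = lin_comb n I c (\<lambda>i. mat_adjoint W * p i)"
    by (rule lin_comb_mult_left) (intro carrier_mat_adjoint W p)+
  moreover have "lin_comb n I c (\<lambda>i. mat_adjoint W * p i) * W = lin_comb n I c (\<lambda>i. mat_adjoint W * p i * W)"
    by (rule lin_comb_mult_right) (intro mult_square_carrier carrier_mat_adjoint W p; assumption)+
  ultimately show ?thesis by (simp add: heisenberg_def)
qed

text \<open>Conjugation by a unitary is a unital *-homomorphism, so it carries an expression in the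
  generators to the same expression in the conjugated generators.\<close>

lemma star_alg_heisenberg:
  assumes W: "W \<in> carrier_mat n n" "mat_adjoint W * W = 1\<^sub>m n" "W * mat_adjoint W = 1\<^sub>m n"
    and S: "S \<subseteq> carrier_mat n n" and A: "A \<in> star_alg n S"
  shows "heisenberg W A \<in> star_alg n (heisenberg W ` S)"
  using A
proof induction
  case one
  then show ?case by (simp add: heisenberg_one W star_alg.one)
next
  case (gen A)
  then show ?case by (auto intro: star_alg.gen)
next
  case (add A B)
  then have c: "A \<in> carrier_mat n n" "B \<in> carrier_mat n n" using star_alg_carrier[OF S] by blast+
  show ?case unfolding heisenberg_add[OF W(1) c] using add.IH by (intro star_alg.add)
next
  case (smult A c)
  then have c: "A \<in> carrier_mat n n" using star_alg_carrier[OF S] by blast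
  show ?case unfolding heisenberg_smult[OF W(1) c] using smult.IH by (intro star_alg.smult)
next
  case (mult A B)
  then have c: "A \<in> carrier_mat n n" "B \<in> carrier_mat n n" using star_alg_carrier[OF S] by blast+
  show ?case unfolding heisenberg_mult[OF W(1,3) c, symmetric] using mult.IH by (intro star_alg.mult)
next
  case (adjoint A)
  then have c: "A \<in> carrier_mat n n" using star_alg_carrier[OF S] by blast
  show ?case unfolding heisenberg_adjoint[OF W(1) c, symmetric] using adjoint.IH by (intro star_alg.adjoint)
qed

text \<open>The indicator functions of the points of a finite probability space, realised as
  operators. Functions on \<open>I\<close> correspond to elements of the algebra;
  \<open>nonzero\<close> makes the correspondence injective and \<open>complete\<close> puts the
  identity into its range.\<close>

locale projection_family =
  fixes n :: nat and I :: "'i set" and p :: "'i \<Rightarrow> complex mat"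
  assumes finite_index: "finite I"
    and carrier: "i \<in> I \<Longrightarrow> p i \<in> carrier_mat n n"
    and self_adjoint: "i \<in> I \<Longrightarrow> mat_adjoint (p i) = p i"
    and orthogonal: "i \<in> I \<Longrightarrow> j \<in> I \<Longrightarrow> p i * p j = (if i = j then p i else 0\<^sub>m n n)"
    and nonzero: "i \<in> I \<Longrightarrow> p i \<noteq> 0\<^sub>m n n"
    and complete: "lin_comb n I (\<lambda>_. 1) p = 1\<^sub>m n"
begin

abbreviation span :: "complex mat set" where
  "span \<equiv> range (\<lambda>c. lin_comb n I c p)"

lemma lin_comb_mult_proj:
  assumes j: "j \<in> I"
  shows "lin_comb n I c p * p j = c j \<cdot>\<^sub>m p j"
proof -
  have "lin_comb n I c p * p j = lin_comb n I c (\<lambda>i. p i * p j)"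
    by (rule lin_comb_mult_right) (auto intro: carrier j)
  also have "\<dots> = lin_comb n I (\<lambda>i. if i = j then c j else 0) p"
    using j carrier by (auto simp: lin_comb_def orthogonal intro!: eq_matI sum.cong)
  also have "\<dots> = c j \<cdot>\<^sub>m p j"
    using j carrier[OF j]
    by (intro eq_matI) (auto simp: lin_comb_def finite_index if_distrib[where f = "\<lambda>x. x * _"] cong: if_cong)
  finally show ?thesis .
qed

text \<open>Multiplying \<open>A\<close> by the resolution of the identity shows that it is
  determined by its products with the projections. Operator identities can thus be checked one
  record at a time.\<close>

lemma eq_lin_combI:
  assumes A: "A \<in> carrier_mat n n" and eig: "\<And>i. i \<in> I \<Longrightarrow> A * p i = c i \<cdot>\<^sub>m p i"
  shows "A = lin_comb n I c p"
proof -
  have "A = A * lin_comb n I (\<lambda>_. 1) p" using A by (simp add: complete mult_one_dim)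
  also have "\<dots> = lin_comb n I (\<lambda>_. 1) (\<lambda>i. A * p i)"
    by (rule lin_comb_mult_left) (auto intro: A carrier)
  also have "\<dots> = lin_comb n I (\<lambda>_. 1) (\<lambda>i. c i \<cdot>\<^sub>m p i)"
    by (rule lin_comb_cong) (auto simp: eig)
  also have "\<dots> = lin_comb n I c p"
    by (subst lin_comb_absorb) (auto intro: carrier)
  finally show ?thesis .
qed

lemma lin_comb_mult: "lin_comb n I c p * lin_comb n I d p = lin_comb n I (\<lambda>i. c i * d i) p"
proof (rule eq_lin_combI)
  fix i assume i: "i \<in> I"
  have "lin_comb n I c p * lin_comb n I d p * p i = lin_comb n I c p * (lin_comb n I d p * p i)"
    using carrier[OF i] by (intro mult_assoc_dim) auto
  then show "lin_comb n I c p * lin_comb n I d p * p i = (c i * d i) \<cdot>\<^sub>m p i"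
    using carrier[OF i]
    by (simp add: lin_comb_mult_proj[OF i] mult_smult_dim smult_smult_mat mult.commute)
qed auto

lemma lin_comb_adjoint_eq: "mat_adjoint (lin_comb n I c p) = lin_comb n I (\<lambda>i. cnj (c i)) p"
  by (subst lin_comb_adjoint) (auto simp: carrier self_adjoint intro: lin_comb_cong)

lemma one_in_span: "1\<^sub>m n \<in> span"
  using complete by (metis rangeI)

lemma proj_eq_lin_comb: "j \<in> I \<Longrightarrow> p j = lin_comb n I (\<lambda>i. if i = j then 1 else 0) p"
  by (rule eq_lin_combI)
    (auto simp: carrier orthogonal one_smult_mat intro!: eq_matI dest: carrier)

lemma proj_in_span: "j \<in> I \<Longrightarrow> p j \<in> span"
  using proj_eq_lin_comb by (metis rangeI)

lemma star_alg_eq_span: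
  assumes S: "S \<subseteq> span" and p: "p ` I \<subseteq> star_alg n S"
  shows "star_alg n S = span"
proof
  show "star_alg n S \<subseteq> span"
  proof
    fix A assume "A \<in> star_alg n S"
    then show "A \<in> span"
    proof induction
      case one
      then show ?case by (rule one_in_span)
    next
      case (gen A)
      then show ?case using S by blast
    qed (auto simp: lin_comb_add lin_comb_smult lin_comb_mult lin_comb_adjoint_eq)
  qed
  show "span \<subseteq> star_alg n S"
    using p by (auto intro!: star_alg_lin_comb finite_index carrier)
qed

lemma lin_comb_eq_iff: "lin_comb n I c p = lin_comb n I d p \<longleftrightarrow> (\<forall>i\<in>I. c i = d i)"
proof
  assume eq: "lin_comb n I c p = lin_comb n I d p"
  show "\<forall>i\<in>I. c i = d i"
  proof
    fix i assume i: "i \<in> I"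
    have "c i \<cdot>\<^sub>m p i = d i \<cdot>\<^sub>m p i"
      using lin_comb_mult_proj[OF i, of c] lin_comb_mult_proj[OF i, of d] eq by simp
    then show "c i = d i" using nonzero[OF i] carrier[OF i] by (rule smult_mat_cancel)
  qed
qed (auto intro: lin_comb_cong)

lemma val_at_lin_comb:
  assumes j: "j \<in> I" shows "val_at (lin_comb n I c p) (p j) = c j"
  unfolding val_at_def lin_comb_mult_proj[OF j]
  by (rule the_equality) (auto dest: smult_mat_cancel[OF _ nonzero[OF j] carrier[OF j]])

text \<open>Projections in the span have coefficients 0 and 1, so they are indicator functions of
  subsets of \<open>I\<close>. The minimal nonzero ones belong to singletons.\<close>

lemma points_span: "points n span = p ` I"
proof
  have idem: "c i = 0 \<or> c i = 1" if "lin_comb n I c p * lin_comb n I c p = lin_comb n I c p" "i \<in> I" for c i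
    using that by (auto simp: lin_comb_mult lin_comb_eq_iff)
  have proj: "p j \<in> projections span" if "j \<in> I" for j
    using that by (simp add: projections_def proj_in_span self_adjoint orthogonal)
  show "p ` I \<subseteq> points n span"
  proof
    fix r assume "r \<in> p ` I"
    then obtain j where j: "j \<in> I" and r: "r = p j" by auto
    have "q = 0\<^sub>m n n \<or> q = p j" if q: "q \<in> projections span" and le: "q * p j = q" for q
    proof -
      from q obtain c where c: "q = lin_comb n I c p" "q * q = q" by (auto simp: projections_def)
      have "q = c j \<cdot>\<^sub>m p j" using le lin_comb_mult_proj[OF j, of c] c by simp
      moreover have "c j = 0 \<or> c j = 1" using idem c j by blast
      moreover have "0 \<cdot>\<^sub>m p j = 0\<^sub>m n n" using carrier[OF j] by (intro eq_matI) auto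
      ultimately show ?thesis by (auto simp: one_smult_mat)
    qed
    then show "r \<in> points n span"
      unfolding r points_def using proj[OF j] nonzero[OF j] by blast
  qed
  show "points n span \<subseteq> p ` I"
  proof
    fix q assume q: "q \<in> points n span"
    then have q': "q \<in> projections span" "q \<noteq> 0\<^sub>m n n"
      and min: "\<And>r. r \<in> projections span \<Longrightarrow> r * q = r \<Longrightarrow> r = 0\<^sub>m n n \<or> r = q"
      by (auto simp: points_def)
    from q' obtain c where c: "q = lin_comb n I c p" "q * q = q" by (auto simp: projections_def)
    have "\<exists>j\<in>I. c j \<noteq> 0"
    proof (rule ccontr)
      assume "\<not> (\<exists>j\<in>I. c j \<noteq> 0)"
      then have "q = 0\<^sub>m n n" unfolding c(1) by (auto simp: lin_comb_def intro!: eq_matI)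
      then show False using q' by simp
    qed
    then obtain j where j: "j \<in> I" "c j \<noteq> 0" by auto
    then have "c j = 1" using idem c by blast
    \<comment> \<open>Minimality of \<open>q\<close> is tested on \<open>p j * q\<close>, whereas
      the eigenvalue equation concerns \<open>q * p j\<close>; adjoints exchange the two.\<close>
    moreover have "p j * q = c j \<cdot>\<^sub>m p j"
    proof -
      have "mat_adjoint (p j * q) = mat_adjoint q * p j"
        unfolding c(1) using carrier[OF j(1)] by (simp add: mat_adjoint_mult self_adjoint[OF j(1)])
      also have "\<dots> = cnj (c j) \<cdot>\<^sub>m p j"
        unfolding c(1) lin_comb_adjoint_eq by (rule lin_comb_mult_proj[OF j(1)])
      finally have "mat_adjoint (mat_adjoint (p j * q)) = mat_adjoint (cnj (c j) \<cdot>\<^sub>m p j)" by simp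
      then show ?thesis using self_adjoint[OF j(1)] by (simp add: mat_adjoint_smult)
    qed
    ultimately have "p j * q = p j" by (simp add: one_smult_mat)
    then have "q = p j" using min[OF proj[OF j(1)]] nonzero[OF j(1)] by auto
    then show "q \<in> p ` I" using j by blast
  qed
qed

lemma commutant_spanI:
  assumes B: "B \<in> carrier_mat n n" and comm: "\<And>i. i \<in> I \<Longrightarrow> p i * B = B * p i"
  shows "B \<in> commutant n span"
proof -
  have "lin_comb n I c p * B = B * lin_comb n I c p" for c
    using B comm carrier
    by (simp add: lin_comb_mult_left lin_comb_mult_right cong: lin_comb_cong)
  then show ?thesis using B by (auto simp: commutant_def)
qed

text \<open>By linearity it suffices to test against the projections, on which \<open>E\<close> acts
  as the scalar \<open>c i\<close>. Where \<open>P (p i) = 0\<close> the coefficient is left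
  free.\<close>

lemma is_cond_exp_iff:
  assumes P: "linear_functional n P" and B: "B \<in> commutant n span"
  shows "is_cond_exp n P span B E \<longleftrightarrow>
    (\<exists>c. E = lin_comb n I c p \<and> (\<forall>i\<in>I. c i * P (p i) = P (B * p i)))"
proof -
  have Bc: "B \<in> carrier_mat n n" using B by (simp add: commutant_def)
  have "(\<forall>d. P (lin_comb n I c p * lin_comb n I d p) = P (B * lin_comb n I d p))
    \<longleftrightarrow> (\<forall>i\<in>I. c i * P (p i) = P (B * p i))" (is "?L \<longleftrightarrow> ?R") for c
  proof
    assume L: ?L
    show ?R
    proof
      fix i assume i: "i \<in> I"
      have "P (lin_comb n I c p * p i) = P (B * p i)"
        using L proj_eq_lin_comb[OF i] by metis
      then show "c i * P (p i) = P (B * p i)"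
        by (simp add: lin_comb_mult_proj[OF i] linear_functional_smult[OF P carrier[OF i]])
    qed
  next
    assume R: ?R
    show ?L
    proof
      fix d
      have "P (lin_comb n I c p * lin_comb n I d p) = (\<Sum>i\<in>I. c i * d i * P (p i))"
        by (simp add: lin_comb_mult linear_functional_lin_comb[OF P finite_index carrier])
      also have "\<dots> = (\<Sum>i\<in>I. d i * P (B * p i))"
        using R by (intro sum.cong) (auto simp: mult.commute mult.left_commute)
      also have "\<dots> = P (lin_comb n I d (\<lambda>i. B * p i))"
        using Bc carrier by (intro linear_functional_lin_comb[OF P finite_index, symmetric]) auto
      also have "\<dots> = P (B * lin_comb n I d p)"
        using Bc carrier by (simp add: lin_comb_mult_left)
      finally show "P (lin_comb n I c p * lin_comb n I d p) = P (B * lin_comb n I d p)" .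
    qed
  qed
  then show ?thesis using B by (auto simp: is_cond_exp_def)
qed

lemma heisenberg_projection_family:
  assumes W: "W \<in> carrier_mat n n" "mat_adjoint W * W = 1\<^sub>m n" "W * mat_adjoint W = 1\<^sub>m n"
  shows "projection_family n I (\<lambda>i. heisenberg W (p i))"
proof
  show "finite I" by (rule finite_index)
  show "lin_comb n I (\<lambda>_. 1) (\<lambda>i. heisenberg W (p i)) = 1\<^sub>m n"
    using heisenberg_lin_comb[OF W(1) carrier, of "I" "\<lambda>i. i" "\<lambda>_. 1"] W
    by (simp add: complete heisenberg_one)
  fix i assume i: "i \<in> I"
  note ci = carrier[OF i]
  show "heisenberg W (p i) \<in> carrier_mat n n" using W ci by simp
  show "mat_adjoint (heisenberg W (p i)) = heisenberg W (p i)"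
    by (simp add: heisenberg_adjoint[OF W(1) ci] self_adjoint i)
  have z: "heisenberg W (0\<^sub>m n n) = 0\<^sub>m n n" using W by (simp add: heisenberg_def)
  show "heisenberg W (p i) * heisenberg W (p j) = (if i = j then heisenberg W (p i) else 0\<^sub>m n n)"
    if j: "j \<in> I" for j
    unfolding heisenberg_mult[OF W(1,3) ci carrier[OF j]] orthogonal[OF i j] by (simp add: z)
  show "heisenberg W (p i) \<noteq> 0\<^sub>m n n"
  proof
    assume 0: "heisenberg W (p i) = 0\<^sub>m n n"
    have "p i = (W * mat_adjoint W) * (p i * (W * mat_adjoint W))"
      unfolding W(3) using ci by (simp add: mat_ring_dim)
    also have "\<dots> = W * heisenberg W (p i) * mat_adjoint W"
      using W(1) ci by (simp add: heisenberg_def mult_assoc_dim)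
    also have "\<dots> = 0\<^sub>m n n" unfolding 0 using W(1) by simp
    finally show False using nonzero[OF i] by simp
  qed
qed

end

subsection \<open>Spectral projections of the quadratures\<close>

lemma commutant_carrier: "A \<in> commutant n S \<Longrightarrow> A \<in> carrier_mat n n"
  by (simp add: commutant_def)

lemma commutantD: "A \<in> commutant n S \<Longrightarrow> B \<in> S \<Longrightarrow> A * B = B * A"
  by (simp add: commutant_def)

lemma commutant_mult:
  assumes S: "S \<subseteq> carrier_mat n n" and A: "A \<in> commutant n S" and B: "B \<in> commutant n S"
  shows "A * B \<in> commutant n S"
proof -
  note c = commutant_carrier[OF A] commutant_carrier[OF B]
  have "Z * (A * B) = A * B * Z" if "Z \<in> S" for Z
  proof -
    have Z: "Z \<in> carrier_mat n n" using S that by blast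
    have "Z * (A * B) = (Z * A) * B" using c Z by (simp add: mult_assoc_dim)
    also have "\<dots> = A * (Z * B)" using c Z by (simp add: commutantD[OF A that, symmetric] mult_assoc_dim)
    also have "\<dots> = A * B * Z" using c Z by (simp add: commutantD[OF B that, symmetric] mult_assoc_dim)
    finally show ?thesis .
  qed
  then show ?thesis using c by (simp add: commutant_def)
qed

lemma commutant_add:
  assumes S: "S \<subseteq> carrier_mat n n" and A: "A \<in> commutant n S" and B: "B \<in> commutant n S"
  shows "A + B \<in> commutant n S"
proof -
  note c = commutant_carrier[OF A] commutant_carrier[OF B]
  have "Z * (A + B) = (A + B) * Z" if "Z \<in> S" for Z
  proof -
    have "Z \<in> carrier_mat n n" using S that by blast
    then show ?thesis using c
      by (simp add: commutantD[OF A that] commutantD[OF B that] mat_ring_dim)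
  qed
  then show ?thesis using c by (simp add: commutant_def)
qed

lemma commutant_smult:
  assumes S: "S \<subseteq> carrier_mat n n" and A: "A \<in> commutant n S"
  shows "c \<cdot>\<^sub>m A \<in> commutant n S"
proof -
  note c = commutant_carrier[OF A]
  have "Z * (c \<cdot>\<^sub>m A) = (c \<cdot>\<^sub>m A) * Z" if "Z \<in> S" for Z
  proof -
    have "Z \<in> carrier_mat n n" using S that by blast
    then show ?thesis using c by (simp add: commutantD[OF A that] mat_ring_dim)
  qed
  then show ?thesis using c by (simp add: commutant_def)
qed

lemma commutant_one:
  assumes S: "S \<subseteq> carrier_mat n n" shows "1\<^sub>m n \<in> commutant n S"
proof -
  have "Z * 1\<^sub>m n = 1\<^sub>m n * Z" if "Z \<in> S" for Z
  proof -
    have "Z \<in> carrier_mat n n" using S that by blast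
    then show ?thesis by (simp add: mat_ring_dim)
  qed
  then show ?thesis by (simp add: commutant_def)
qed

lemma commutant_sym:
  "A \<in> commutant n {B} \<Longrightarrow> B \<in> carrier_mat n n \<Longrightarrow> B \<in> commutant n {A}"
  by (simp add: commutant_def)

lemma commutant_mono: "A \<in> commutant n S \<Longrightarrow> R \<subseteq> S \<Longrightarrow> A \<in> commutant n R"
  by (auto simp: commutant_def)

text \<open>The dimension is written in the form to which the simplifier brings
  \<open>2 ^ Suc k\<close>.\<close>

abbreviation ops :: "nat \<Rightarrow> complex mat set" where
  "ops k \<equiv> carrier_mat (2 * 2 ^ k) (2 * 2 ^ k)"

abbreviation slot_ops :: "nat \<Rightarrow> nat \<Rightarrow> complex mat set" where
  "slot_ops k i \<equiv> slot k i ` M2"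

lemma slot_carrier [simp]: "A \<in> M2 \<Longrightarrow> i \<le> k \<Longrightarrow> slot k i A \<in> ops k"
  by (rule carrier_matI) simp_all

lemma slot_ops_subset: "i \<le> k \<Longrightarrow> slot_ops k i \<subseteq> ops k"
  by auto

lemma slot_in_commutant:
  "A \<in> M2 \<Longrightarrow> i \<noteq> j \<Longrightarrow> i \<le> k \<Longrightarrow> j \<le> k \<Longrightarrow> slot k j A \<in> commutant (2 * 2 ^ k) (slot_ops k i)"
  by (auto simp: commutant_def intro: slot_commute')

definition outcome :: "bool \<Rightarrow> complex" where
  "outcome b = (if b then 1 else - 1)"

definition quadrature :: "complex mat" where
  "quadrature = mat 2 2 (\<lambda>(i, j). if i = j then 0 else 1)"

text \<open>The spectral projection of the Pauli matrix \<open>quadrature\<close> at the eigenvalue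
  \<open>outcome b\<close>. Its diagonal entry is the source of the factor \<open>1 / 2\<close> per
  observed slot.\<close>

definition quad_proj :: "bool \<Rightarrow> complex mat" where
  "quad_proj b = mat 2 2 (\<lambda>(i, j). if i = j then 1 / 2 else outcome b / 2)"

lemma quad_carrier [simp]: "quadrature \<in> M2" "quad_proj b \<in> M2"
  by (simp_all add: quadrature_def quad_proj_def)

lemma sigma_minus_eq: "sigma_minus = mat 2 2 (\<lambda>(i, j). if i = 1 \<and> j = 0 then 1 else 0)"
  by (rule eq_matI) (auto simp: sigma_minus_def mat_of_rows_list_def less_2_cases_iff)

lemma sigma_plus_eq: "sigma_plus = mat 2 2 (\<lambda>(i, j). if i = 0 \<and> j = 1 then 1 else 0)"
  by (rule eq_matI) (auto simp: sigma_plus_def sigma_minus_eq less_2_cases_iff)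

lemma sigma_carrier [simp]: "sigma_minus \<in> M2" "sigma_plus \<in> M2"
  by (simp_all add: sigma_minus_eq sigma_plus_eq)

lemma sum_below_2: "(\<Sum>r = 0..<2::nat. f r) = f 0 + (f 1 :: complex)"
  by (simp add: numeral_2_eq_2)

lemma quadrature_eq: "sigma_minus + sigma_plus = quadrature"
  by (rule eq_matI) (auto simp: sigma_minus_eq sigma_plus_eq quadrature_def less_2_cases_iff)

lemma quad_proj_adjoint: "mat_adjoint (quad_proj b) = quad_proj b"
  by (rule eq_matI) (auto simp: quad_proj_def outcome_def)

text \<open>The zero matrix is written as a multiple of the identity because
  \<open>slot_smult\<close> and \<open>slot_one\<close> carry this form to the full space.\<close>

lemma quad_proj_mult: "quad_proj b * quad_proj c = (if b = c then quad_proj b else 0 \<cdot>\<^sub>m 1\<^sub>m 2)"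
  by (rule eq_matI)
    (auto simp: quad_proj_def outcome_def scalar_prod_def sum_below_2 less_2_cases_iff)

lemma quad_proj_sum: "quad_proj True + quad_proj False = 1\<^sub>m 2"
  by (rule eq_matI) (auto simp: quad_proj_def outcome_def)

lemma quadrature_quad_proj:
  "quadrature * quad_proj b = outcome b \<cdot>\<^sub>m quad_proj b"
  "quad_proj b * quadrature = outcome b \<cdot>\<^sub>m quad_proj b"
  by (rule eq_matI;
    auto simp: quad_proj_def quadrature_def outcome_def scalar_prod_def sum_below_2 less_2_cases_iff)+

lemma quad_proj_eq: "quad_proj b = (1 / 2) \<cdot>\<^sub>m (1\<^sub>m 2 + outcome b \<cdot>\<^sub>m quadrature)"
  by (rule eq_matI) (auto simp: quad_proj_def quadrature_def)

lemma vac_proj_sandwich: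
  assumes "A \<in> M2" shows "vac_proj * (A * vac_proj) = A $$ (1, 1) \<cdot>\<^sub>m vac_proj"
  using assms
  by (intro eq_matI) (auto simp: vac_proj_def scalar_prod_def sum_below_2 less_2_cases_iff)

lemma vac_proj_adjoint: "mat_adjoint vac_proj = vac_proj"
  by (rule eq_matI) (auto simp: vac_proj_def)

lemma sigma_minus_vac_proj: "sigma_minus * vac_proj = 0 \<cdot>\<^sub>m 1\<^sub>m 2"
  by (rule eq_matI) (auto simp: vac_proj_def sigma_minus_eq scalar_prod_def sum_below_2 less_2_cases_iff)

lemma slot_sigma_minus_vac_embed:
  assumes "1 \<le> i" "i \<le> k"
  shows "slot k i sigma_minus * vac_embed k = 0\<^sub>m (2 * 2 ^ k) 2"
proof -
  have "slot k i sigma_minus * vac_embed k = slot k i sigma_minus * (slot k i vac_proj * vac_embed k)"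
    using assms by (simp add: slot_vac_proj_vac_embed)
  also have "\<dots> = slot k i (sigma_minus * vac_proj) * vac_embed k"
    using assms by (simp add: slot_mult mult_assoc_dim)
  also have "\<dots> = 0 \<cdot>\<^sub>m vac_embed k"
    unfolding sigma_minus_vac_proj slot_smult using assms by (simp add: slot_one smult_mult_dim one_mult_dim)
  also have "\<dots> = 0\<^sub>m (2 * 2 ^ k) 2" by (rule eq_matI) auto
  finally show ?thesis .
qed

text \<open>The slice map that evaluates all field factors in the vacuum and leaves a system
  operator. Followed by \<rho> it is the product state.\<close>

definition compress :: "nat \<Rightarrow> complex mat \<Rightarrow> complex mat" where
  "compress k Z = mat_adjoint (vac_embed k) * (Z * vac_embed k)"

lemma compress_carrier [simp]: "compress k Z \<in> M2"
  by (rule carrier_matI) (simp_all add: compress_def)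

text \<open>A vacuum projection of slot \<open>i\<close> is inserted at both ends. The left one
  passes \<open>Z\<close>, and \<open>A\<close> between the two copies becomes a scalar multiple of
  the projection.\<close>

lemma compress_mult_slot:
  assumes i: "1 \<le> i" "i \<le> k" and A: "A \<in> M2" and Z: "Z \<in> commutant (2 * 2 ^ k) (slot_ops k i)"
  shows "compress k (Z * slot k i A) = A $$ (1, 1) \<cdot>\<^sub>m compress k Z"
proof -
  let ?J = "vac_embed k" and ?v = "slot k i vac_proj"
  note Zc = commutant_carrier[OF Z]
  have J: "?v * ?J = ?J" using i by (rule slot_vac_proj_vac_embed)
  have J': "mat_adjoint ?J * ?v = mat_adjoint ?J"
  proof -
    have "mat_adjoint (?v * ?J) = mat_adjoint ?J * ?v"
      using i by (simp add: mat_adjoint_mult slot_adjoint vac_proj_adjoint)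
    then show ?thesis by (simp add: J)
  qed
  have comm: "?v * Z = Z * ?v" using commutantD[OF Z, of ?v] by simp
  have "compress k (Z * slot k i A) = (mat_adjoint ?J * ?v) * ((Z * slot k i A) * (?v * ?J))"
    by (simp add: compress_def J J')
  also have "\<dots> = mat_adjoint ?J * ((?v * Z) * (slot k i A * (?v * ?J)))"
    using i A Zc by (simp add: mult_assoc_dim)
  also have "\<dots> = mat_adjoint ?J * (Z * ((?v * (slot k i A * ?v)) * ?J))"
    unfolding comm using i A Zc by (simp add: mult_assoc_dim)
  also have "?v * (slot k i A * ?v) = A $$ (1, 1) \<cdot>\<^sub>m ?v"
    using A by (simp add: slot_mult[symmetric] vac_proj_sandwich slot_smult del: slot_carrier)
  also have "mat_adjoint ?J * (Z * ((A $$ (1, 1) \<cdot>\<^sub>m ?v) * ?J)) = A $$ (1, 1) \<cdot>\<^sub>m compress k Z"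
    using i Zc by (simp add: compress_def smult_mult_dim mult_smult_dim J)
  finally show ?thesis .
qed

lemma compress_sys_mult:
  assumes A: "A \<in> M2" and Z: "Z \<in> ops k"
  shows "compress k (sys k A * Z) = A * compress k Z"
proof -
  let ?J = "vac_embed k"
  have "mat_adjoint (sys k (mat_adjoint A) * ?J) = mat_adjoint (?J * mat_adjoint A)"
    using A by (simp add: sys_vac_embed)
  then have *: "mat_adjoint ?J * sys k A = A * mat_adjoint ?J"
    using A by (simp add: mat_adjoint_mult slot_adjoint)
  have "compress k (sys k A * Z) = (mat_adjoint ?J * sys k A) * (Z * ?J)"
    using A Z by (simp add: compress_def mult_assoc_dim)
  also have "\<dots> = A * compress k Z"
    unfolding * using A Z by (simp add: compress_def mult_assoc_dim)
  finally show ?thesis .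
qed

lemma compress_add: "A \<in> ops k \<Longrightarrow> B \<in> ops k \<Longrightarrow> compress k (A + B) = compress k A + compress k B"
  by (simp add: compress_def mat_ring_dim)

lemma compress_smult: "A \<in> ops k \<Longrightarrow> compress k (c \<cdot>\<^sub>m A) = c \<cdot>\<^sub>m compress k A"
  by (simp add: compress_def mat_ring_dim)

lemma is_state_linear: "is_state n f \<Longrightarrow> linear_functional n f"
  by (simp add: is_state_def linear_functional_def)

lemma prod_state_eq: "Z \<in> ops k \<Longrightarrow> prod_state \<rho> k Z = \<rho> (compress k Z)"
  unfolding compress_def by (rule prod_state_compress)

lemma prod_state_linear:
  assumes "is_state 2 \<rho>"
  shows "linear_functional (2 * 2 ^ k) (prod_state \<rho> k)"
  using is_state_linear[OF assms]
  by (auto simp: linear_functional_def prod_state_eq compress_add compress_smult)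

text \<open>Outcomes are listed in reverse order: the head belongs to the last slot observed.\<close>

primrec record_proj :: "nat \<Rightarrow> bool list \<Rightarrow> complex mat" where
  "record_proj k [] = 1\<^sub>m (2 * 2 ^ k)"
| "record_proj k (b # bs) = record_proj k bs * slot k (Suc (length bs)) (quad_proj b)"

lemma record_proj_carrier [simp]: "length bs \<le> k \<Longrightarrow> record_proj k bs \<in> ops k"
  by (induction bs) auto

lemma dim_record_proj [simp]:
  assumes "length bs \<le> k"
  shows "dim_row (record_proj k bs) = 2 * 2 ^ k" "dim_col (record_proj k bs) = 2 * 2 ^ k"
  using record_proj_carrier[OF assms] by (metis carrier_matD)+

lemma record_proj_in_commutant:
  assumes "length bs \<le> k" "S \<subseteq> ops k"
    and "\<And>i b. 1 \<le> i \<Longrightarrow> i \<le> length bs \<Longrightarrow> slot k i (quad_proj b) \<in> commutant (2 * 2 ^ k) S"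
  shows "record_proj k bs \<in> commutant (2 * 2 ^ k) S"
  using assms by (induction bs) (auto intro: commutant_one commutant_mult)

lemma record_proj_in_commutant_slot:
  assumes "length bs \<le> k" "i \<le> k" "i = 0 \<or> length bs < i"
  shows "record_proj k bs \<in> commutant (2 * 2 ^ k) (slot_ops k i)"
  using assms by (intro record_proj_in_commutant slot_ops_subset slot_in_commutant) auto

lemma slot_quad_proj_commute:
  assumes "i \<le> k" "j \<le> k"
  shows "slot k i (quad_proj b) \<in> commutant (2 * 2 ^ k) {slot k j (quad_proj c)}"
proof (cases "i = j")
  case True
  have "quad_proj c * quad_proj b = quad_proj b * quad_proj c" by (simp add: quad_proj_mult)
  then show ?thesis using True assms by (simp add: commutant_def flip: slot_mult)
next
  case False
  then show ?thesis using slot_in_commutant[of "quad_proj b" j i k] assms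
    by (auto intro: commutant_mono)
qed

lemma record_proj_mult_slot:
  assumes "length bs \<le> k" "j \<le> k"
  shows "record_proj k bs * slot k j (quad_proj b) = slot k j (quad_proj b) * record_proj k bs"
proof -
  have "record_proj k bs \<in> commutant (2 * 2 ^ k) {slot k j (quad_proj b)}"
    using assms by (intro record_proj_in_commutant slot_quad_proj_commute) auto
  then show ?thesis by (rule commutantD) simp
qed

lemma record_proj_adjoint: "length bs \<le> k \<Longrightarrow> mat_adjoint (record_proj k bs) = record_proj k bs"
proof (induction bs)
  case (Cons b bs)
  then show ?case
    by (simp add: mat_adjoint_mult slot_adjoint quad_proj_adjoint record_proj_mult_slot)
qed simp

text \<open>The factor of the last slot moves past the shorter record projection, so the product is
  formed slot by slot and a single disagreement makes it zero.\<close>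

lemma record_proj_orthogonal:
  assumes "length bs = length cs" "length bs \<le> k"
  shows "record_proj k bs * record_proj k cs = (if bs = cs then record_proj k bs else 0\<^sub>m (2 * 2 ^ k) (2 * 2 ^ k))"
  using assms
proof (induction bs cs rule: list_induct2)
  case Nil
  then show ?case by simp
next
  case (Cons b bs c cs)
  let ?s = "slot k (Suc (length bs))"
  have "record_proj k (b # bs) * record_proj k (c # cs)
      = record_proj k bs * ((?s (quad_proj b) * record_proj k cs) * ?s (quad_proj c))"
    using Cons by (simp add: mult_assoc_dim)
  also have "\<dots> = (record_proj k bs * record_proj k cs) * (?s (quad_proj b) * ?s (quad_proj c))"
  proof -
    have comm: "?s (quad_proj b) * record_proj k cs = record_proj k cs * ?s (quad_proj b)"
      using Cons.hyps Cons.prems by (simp add: record_proj_mult_slot)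
    show ?thesis unfolding comm using Cons.hyps Cons.prems by (simp add: mult_assoc_dim)
  qed
  also have "?s (quad_proj b) * ?s (quad_proj c) = (if b = c then ?s (quad_proj b) else 0\<^sub>m (2 * 2 ^ k) (2 * 2 ^ k))"
  proof (cases "b = c")
    case False
    have "0 \<cdot>\<^sub>m 1\<^sub>m (2 * 2 ^ k) = (0\<^sub>m (2 * 2 ^ k) (2 * 2 ^ k) :: complex mat)" by (rule eq_matI) auto
    then show ?thesis using Cons False by (simp add: slot_mult[symmetric] quad_proj_mult slot_smult slot_one)
  qed (simp add: slot_mult[symmetric] quad_proj_mult)
  finally show ?case using Cons by auto
qed

text \<open>The factor split off acts on a slot that the shorter record does not touch, so it
  contributes its vacuum entry \<open>1 / 2\<close>.\<close>

lemma compress_record_proj: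
  "length bs \<le> k \<Longrightarrow> compress k (record_proj k bs) = (1 / 2) ^ length bs \<cdot>\<^sub>m 1\<^sub>m 2"
proof (induction bs)
  case Nil
  then show ?case by (simp add: compress_def vac_embed_isometry one_mult_dim one_smult_mat)
next
  case (Cons b bs)
  then show ?case
    by (simp add: compress_mult_slot record_proj_in_commutant_slot smult_smult_mat)
       (simp add: quad_proj_def)
qed

lemma finite_lists_length [simp]: "finite {bs :: bool list. length bs = l}"
  using finite_lists_length_eq[of "UNIV :: bool set" l] by simp

text \<open>Splitting the records by the outcome in the last slot leaves the sum of the two spectral
  projections there, which is the identity.\<close>

lemma record_proj_complete:
  "l \<le> k \<Longrightarrow> lin_comb (2 * 2 ^ k) {bs. length bs = l} (\<lambda>_. 1) (record_proj k) = 1\<^sub>m (2 * 2 ^ k)"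
proof (induction l)
  case 0
  show ?case by (rule eq_matI) (simp_all add: lin_comb_def)
next
  case (Suc l)
  let ?n = "2 * 2 ^ k :: nat" and ?I = "{bs :: bool list. length bs = l}"
  have sum_split: "(\<Sum>bs | length bs = Suc l. f bs) = (\<Sum>bs\<in>?I. f (True # bs)) + (\<Sum>bs\<in>?I. f (False # bs))"
    for f :: "bool list \<Rightarrow> complex"
  proof -
    have "{bs :: bool list. length bs = Suc l} = (#) True ` ?I \<union> (#) False ` ?I"
      by (force simp: length_Suc_conv image_def)
    then have "(\<Sum>bs | length bs = Suc l. f bs) = (\<Sum>bs\<in>(#) True ` ?I. f bs) + (\<Sum>bs\<in>(#) False ` ?I. f bs)"
      by (simp only:) (rule sum.union_disjoint; auto)
    then show ?thesis by (simp add: sum.reindex)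
  qed
  have "lin_comb ?n {bs. length bs = Suc l} (\<lambda>_. 1) (record_proj k)
      = lin_comb ?n ?I (\<lambda>_. 1) (\<lambda>bs. record_proj k (True # bs)) + lin_comb ?n ?I (\<lambda>_. 1) (\<lambda>bs. record_proj k (False # bs))"
    by (rule eq_matI) (simp_all add: lin_comb_def sum_split del: record_proj.simps)
  also have "\<dots> = lin_comb ?n ?I (\<lambda>_. 1) (record_proj k) * slot k (Suc l) (quad_proj True)
      + lin_comb ?n ?I (\<lambda>_. 1) (record_proj k) * slot k (Suc l) (quad_proj False)"
    using Suc by (subst (1 2) lin_comb_mult_right) (auto intro!: arg_cong2[where f = "(+)"] lin_comb_cong)
  also have "\<dots> = slot k (Suc l) (quad_proj True + quad_proj False)"
    using Suc by (simp add: one_mult_dim slot_add)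
  also have "\<dots> = 1\<^sub>m ?n" using Suc by (simp add: quad_proj_sum slot_one)
  finally show ?case .
qed

text \<open>A record projection cannot vanish because its vacuum compression is a nonzero multiple
  of the identity.\<close>

lemma record_proj_family:
  assumes "l \<le> k"
  shows "projection_family (2 * 2 ^ k) {bs. length bs = l} (record_proj k)"
proof
  show "record_proj k bs \<noteq> 0\<^sub>m (2 * 2 ^ k) (2 * 2 ^ k)" if "bs \<in> {bs. length bs = l}" for bs
  proof
    assume "record_proj k bs = 0\<^sub>m (2 * 2 ^ k) (2 * 2 ^ k)"
    then have "compress k (0\<^sub>m (2 * 2 ^ k) (2 * 2 ^ k)) = (1 / 2) ^ length bs \<cdot>\<^sub>m 1\<^sub>m 2"
      using compress_record_proj[of bs k] that assms by simp
    moreover have "compress k (0\<^sub>m (2 * 2 ^ k) (2 * 2 ^ k)) = 0\<^sub>m 2 2"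
    proof -
      have "0\<^sub>m (2 * 2 ^ k) (2 * 2 ^ k) * vac_embed k = 0\<^sub>m (2 * 2 ^ k) 2"
        by (rule left_mult_zero_mat) (rule carrier_matI; simp)
      moreover have "mat_adjoint (vac_embed k) * 0\<^sub>m (2 * 2 ^ k) 2 = 0\<^sub>m 2 2"
        by (rule right_mult_zero_mat) (rule carrier_matI; simp)
      ultimately show ?thesis by (simp add: compress_def)
    qed
    ultimately have "(0\<^sub>m 2 2 :: complex mat) $$ (0, 0) = ((1 / 2) ^ length bs \<cdot>\<^sub>m 1\<^sub>m 2) $$ (0, 0)" by simp
    then show False by simp
  qed
qed (use assms in \<open>auto simp: record_proj_complete record_proj_adjoint record_proj_orthogonal\<close>)

subsection \<open>The dynamics\<close>

lemma dA_carrier [simp]: "i \<le> k \<Longrightarrow> dA k lam i \<in> ops k"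
  and dAstar_carrier [simp]: "i \<le> k \<Longrightarrow> dAstar k lam i \<in> ops k"
  and dLambda_carrier [simp]: "i \<le> k \<Longrightarrow> dLambda k i \<in> ops k"
  and dt_carrier [simp]: "dt k lam i \<in> ops k"
  by (simp_all add: dA_def dAstar_def dLambda_def dt_def)

lemma dim_increments [simp]:
  "i \<le> k \<Longrightarrow> dim_row (dA k lam i) = 2 * 2 ^ k" "i \<le> k \<Longrightarrow> dim_col (dA k lam i) = 2 * 2 ^ k"
  "i \<le> k \<Longrightarrow> dim_row (dAstar k lam i) = 2 * 2 ^ k" "i \<le> k \<Longrightarrow> dim_col (dAstar k lam i) = 2 * 2 ^ k"
  "i \<le> k \<Longrightarrow> dim_row (dLambda k i) = 2 * 2 ^ k" "i \<le> k \<Longrightarrow> dim_col (dLambda k i) = 2 * 2 ^ k"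
  "dim_row (dt k lam i) = 2 * 2 ^ k" "dim_col (dt k lam i) = 2 * 2 ^ k"
  by (simp_all add: dA_def dAstar_def dLambda_def dt_def)

lemma noise_eq:
  "i \<le> k \<Longrightarrow> dA k lam i + dAstar k lam i = complex_of_real lam \<cdot>\<^sub>m slot k i quadrature"
  by (simp add: dA_def dAstar_def slot_add smult_add_dim flip: quadrature_eq)

lemma adjoint_increments:
  assumes "i \<le> k"
  shows "mat_adjoint (dA k lam i) = dAstar k lam i" "mat_adjoint (dAstar k lam i) = dA k lam i"
    "mat_adjoint (dLambda k i) = dLambda k i" "mat_adjoint (dt k lam i) = dt k lam i"
proof -
  have [simp]: "mat_adjoint sigma_minus = sigma_plus" "mat_adjoint sigma_plus = sigma_minus"
    by (simp_all add: sigma_plus_def)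
  have [simp]: "dim_col sigma_plus = 2" "dim_row sigma_minus = 2"
    by (simp_all add: sigma_plus_eq sigma_minus_eq)
  show "mat_adjoint (dA k lam i) = dAstar k lam i" "mat_adjoint (dAstar k lam i) = dA k lam i"
    "mat_adjoint (dLambda k i) = dLambda k i" "mat_adjoint (dt k lam i) = dt k lam i"
    by (simp_all add: dA_def dAstar_def dLambda_def dt_def mat_adjoint_smult slot_adjoint mat_adjoint_mult)
qed

lemma increments_in_commutant:
  assumes "i \<noteq> l" "i \<le> k" "l \<le> k"
  shows "dA k lam l \<in> commutant (2 * 2 ^ k) (slot_ops k i)"
    "dAstar k lam l \<in> commutant (2 * 2 ^ k) (slot_ops k i)"
    "dLambda k l \<in> commutant (2 * 2 ^ k) (slot_ops k i)"
    "dt k lam l \<in> commutant (2 * 2 ^ k) (slot_ops k i)"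
  using assms slot_ops_subset[of i k]
  by (simp_all add: dA_def dAstar_def dLambda_def dt_def commutant_smult commutant_one slot_in_commutant)

lemma sys_increment_commute:
  assumes "A \<in> M2" "1 \<le> l" "l \<le> k"
  shows "dA k lam l * sys k A = sys k A * dA k lam l"
    "dAstar k lam l * sys k A = sys k A * dAstar k lam l"
    "dLambda k l * sys k A = sys k A * dLambda k l"
    "dt k lam l * sys k A = sys k A * dt k lam l"
  using assms increments_in_commutant[of 0 l k, THEN commutantD, of "sys k A"] by auto

text \<open>The exponent is \<open>- \<i>\<close> times a self-adjoint operator: the terms with
  \<open>L2\<close> and its adjoint are exchanged by the adjoint, up to an order of factors that is
  immaterial since slots 0 and \<open>l\<close> commute.\<close>

lemma interaction_unitary:
  assumes L: "L1 \<in> M2" "L2 \<in> M2" "L3 \<in> M2" "mat_adjoint L1 = L1" "mat_adjoint L3 = L3"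
    and l: "1 \<le> l" "l \<le> k"
  shows "interaction k lam L1 L2 L3 l \<in> ops k"
    "mat_adjoint (interaction k lam L1 L2 L3 l) * interaction k lam L1 L2 L3 l = 1\<^sub>m (2 * 2 ^ k)"
    "interaction k lam L1 L2 L3 l * mat_adjoint (interaction k lam L1 L2 L3 l) = 1\<^sub>m (2 * 2 ^ k)"
proof -
  define a b c d where "a = sys k L1 * dLambda k l" and "b = sys k L2 * dAstar k lam l"
    and "c = sys k (mat_adjoint L2) * dA k lam l" and "d = sys k L3 * dt k lam l"
  have carr: "a \<in> ops k" "b \<in> ops k" "c \<in> ops k" "d \<in> ops k"
    using L l by (simp_all add: a_def b_def c_def d_def)
  have adj: "mat_adjoint a = a" "mat_adjoint b = c" "mat_adjoint c = b" "mat_adjoint d = d"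
    using L l
    by (simp_all add: a_def b_def c_def d_def mat_adjoint_mult slot_adjoint adjoint_increments
        sys_increment_commute)
  let ?G = "(- \<i>) \<cdot>\<^sub>m (a + b + c + d)"
  have G: "?G \<in> ops k" using carr by simp
  have "mat_adjoint ?G = (-1) \<cdot>\<^sub>m ?G"
    using carr by (simp add: mat_adjoint_simps adj smult_smult_mat)
      (rule eq_matI; simp add: algebra_simps)
  note U = mat_exp_unitary[OF G this]
  show "interaction k lam L1 L2 L3 l \<in> ops k"
    "mat_adjoint (interaction k lam L1 L2 L3 l) * interaction k lam L1 L2 L3 l = 1\<^sub>m (2 * 2 ^ k)"
    "interaction k lam L1 L2 L3 l * mat_adjoint (interaction k lam L1 L2 L3 l) = 1\<^sub>m (2 * 2 ^ k)"
    using U mat_exp_carrier[OF G]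
    by (simp_all add: interaction_def a_def b_def c_def d_def)
qed

text \<open>The increment \<open>1 + Mp (\<Delta>A + \<Delta>A\<^sup>*) + Mo \<Delta>t\<close> of \<open>V\<close>, with \<open>\<Delta>A + \<Delta>A\<^sup>*\<close> replaced by its
  eigenvalue \<open>\<plusminus>\<lambda>\<close>.\<close>

definition kraus :: "real \<Rightarrow> complex mat \<Rightarrow> complex mat \<Rightarrow> bool \<Rightarrow> complex mat" where
  "kraus lam Mp Mo b = 1\<^sub>m 2 + ((lam * outcome b) \<cdot>\<^sub>m Mp + complex_of_real (lam\<^sup>2) \<cdot>\<^sub>m Mo)"

primrec kraus_prod :: "real \<Rightarrow> complex mat \<Rightarrow> complex mat \<Rightarrow> bool list \<Rightarrow> complex mat" where
  "kraus_prod lam Mp Mo [] = 1\<^sub>m 2"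
| "kraus_prod lam Mp Mo (b # bs) = kraus lam Mp Mo b * kraus_prod lam Mp Mo bs"

lemma kraus_carrier [simp]: "Mp \<in> M2 \<Longrightarrow> Mo \<in> M2 \<Longrightarrow> kraus lam Mp Mo b \<in> M2"
  by (simp add: kraus_def)

lemma kraus_prod_carrier [simp]: "Mp \<in> M2 \<Longrightarrow> Mo \<in> M2 \<Longrightarrow> kraus_prod lam Mp Mo bs \<in> M2"
  by (induction bs) simp_all

text \<open>Since \<open>outcome b\<close> squares to 1, the terms even in it form
  \<open>lindblad\<close> and the odd ones form \<open>jump\<close>. The surplus powers of
  \<open>lam\<close> in the terms of higher order are the factors \<open>lam\<^sup>2\<close> inside
  these two maps.\<close>

lemma kraus_conj:
  assumes M: "Mp \<in> M2" "Mo \<in> M2" and X: "X \<in> M2"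
  shows "heisenberg (kraus lam Mp Mo b) X
    = X + (complex_of_real (lam\<^sup>2) \<cdot>\<^sub>m lindblad lam Mp Mo X + (lam * outcome b) \<cdot>\<^sub>m jump lam Mp Mo X)"
proof -
  have s: "cnj (outcome b) = outcome b" "outcome b * outcome b = 1" "outcome b * (outcome b * z) = z" for z
    by (simp_all add: outcome_def)
  have "heisenberg (kraus lam Mp Mo b) X
    = (1\<^sub>m 2 + ((lam * outcome b) \<cdot>\<^sub>m mat_adjoint Mp + complex_of_real (lam\<^sup>2) \<cdot>\<^sub>m mat_adjoint Mo)) * X
      * (1\<^sub>m 2 + ((lam * outcome b) \<cdot>\<^sub>m Mp + complex_of_real (lam\<^sup>2) \<cdot>\<^sub>m Mo))"
    using M by (simp add: heisenberg_def kraus_def mat_adjoint_simps s)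
  also have "\<dots> = X + (complex_of_real (lam\<^sup>2) \<cdot>\<^sub>m lindblad lam Mp Mo X + (lam * outcome b) \<cdot>\<^sub>m jump lam Mp Mo X)"
    using M X
    by (simp add: lindblad_def jump_def mat_ring_dim)
      (rule eq_matI; simp add: algebra_simps s power2_eq_square del: index_mult_mat(1))
  finally show ?thesis .
qed

text \<open>The relation between \<open>lam\<close>, \<open>T\<close> and \<open>k\<close> enters as
  \<open>lam_nonzero\<close>: dividing an increment by \<open>lam\<close> recovers the
  quadrature.\<close>

locale repeated_interaction =
  fixes k :: nat and lam :: real and \<rho> :: "complex mat \<Rightarrow> complex"
    and L1 L2 L3 Mpm Mp Mm Mo :: "complex mat"
  assumes lam_nonzero: "lam \<noteq> 0" and state: "is_state 2 \<rho>"
    and L: "L1 \<in> M2" "L2 \<in> M2" "L3 \<in> M2" "mat_adjoint L1 = L1" "mat_adjoint L3 = L3"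
    and M: "Mpm \<in> M2" "Mp \<in> M2" "Mm \<in> M2" "Mo \<in> M2"
    and M_decomp: "\<And>l. 1 \<le> l \<Longrightarrow> l \<le> k \<Longrightarrow>
      interaction k lam L1 L2 L3 l - 1\<^sub>m (2 * 2 ^ k) =
        sys k Mpm * dLambda k l + sys k Mp * dAstar k lam l
        + sys k Mm * dA k lam l + sys k Mo * dt k lam l"
begin

abbreviation "n \<equiv> 2 * 2 ^ k :: nat"
abbreviation "step \<equiv> interaction k lam L1 L2 L3"
abbreviation "U \<equiv> evolution k lam L1 L2 L3"
abbreviation "V \<equiv> change_op k lam Mp Mo"
abbreviation "K \<equiv> kraus_prod lam Mp Mo"
abbreviation "noise i \<equiv> dA k lam i + dAstar k lam i"
abbreviation "records l \<equiv> {bs :: bool list. length bs = l}"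
abbreviation "P \<equiv> prod_state \<rho> k"
abbreviation "J \<equiv> vac_embed k"
text \<open>Up to normalisation, the system state conditioned on the record \<open>bs\<close>. Its
  value at the identity is the likelihood ratio of \<open>bs\<close> between the observed record and
  fair coin tossing.\<close>

abbreviation "weight bs X \<equiv> \<rho> (heisenberg (K bs) X)"

lemmas step_unitary = interaction_unitary[OF L, of _ k lam]

lemma step_eq:
  assumes l: "1 \<le> l" "l \<le> k"
  shows "step l = 1\<^sub>m n + (sys k Mpm * dLambda k l + sys k Mp * dAstar k lam l
        + sys k Mm * dA k lam l + sys k Mo * dt k lam l)"
  unfolding M_decomp[OF l, symmetric] using step_unitary(1)[OF l]
  by (intro eq_matI) auto

lemma U_carrier [simp]: "l \<le> k \<Longrightarrow> U l \<in> carrier_mat n n"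
  by (induction l) (simp_all add: step_unitary(1))

lemma dim_U [simp]: "l \<le> k \<Longrightarrow> dim_row (U l) = n" "l \<le> k \<Longrightarrow> dim_col (U l) = n"
  using U_carrier by (metis carrier_matD)+

lemma V_carrier [simp]: "l \<le> k \<Longrightarrow> V l \<in> carrier_mat n n"
  by (induction l) (simp_all add: M)

lemma dim_V [simp]: "l \<le> k \<Longrightarrow> dim_row (V l) = n" "l \<le> k \<Longrightarrow> dim_col (V l) = n"
  using V_carrier by (metis carrier_matD)+

lemma U_unitary:
  "l \<le> k \<Longrightarrow> mat_adjoint (U l) * U l = 1\<^sub>m n \<and> U l * mat_adjoint (U l) = 1\<^sub>m n"
proof (induction l)
  case 0
  then show ?case by (simp add: one_mult_dim)
next
  case (Suc l)
  let ?M = "step (Suc l)"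
  have Mc: "?M \<in> carrier_mat n n" "mat_adjoint ?M * ?M = 1\<^sub>m n" "?M * mat_adjoint ?M = 1\<^sub>m n"
    using step_unitary[of "Suc l"] Suc.prems by simp_all
  have l: "l \<le> k" using Suc.prems by simp
  note IH = Suc.IH[OF l]
  have "mat_adjoint (U (Suc l)) * U (Suc l) = mat_adjoint (U l) * ((mat_adjoint ?M * ?M) * U l)"
    using Mc(1) l by (simp add: mat_adjoint_mult mult_assoc_dim)
  moreover have "U (Suc l) * mat_adjoint (U (Suc l)) = ?M * ((U l * mat_adjoint (U l)) * mat_adjoint ?M)"
    using Mc(1) l by (simp add: mat_adjoint_mult mult_assoc_dim)
  ultimately show ?case
    using IH Mc l by (simp add: one_mult_dim)
qed

lemma step_in_commutant:
  assumes "1 \<le> l" "l \<le> k" "1 \<le> i" "i \<le> k" "i \<noteq> l"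
  shows "step l \<in> commutant n (slot_ops k i)"
  unfolding step_eq[OF assms(1,2)] using assms M
  by (intro commutant_add commutant_mult commutant_one increments_in_commutant slot_in_commutant
      slot_ops_subset) auto

lemma V_in_commutant:
  assumes "l < i" "i \<le> k"
  shows "V l \<in> commutant n (slot_ops k i)"
  using assms
proof (induction l)
  case 0
  then show ?case by (simp add: commutant_one slot_ops_subset)
next
  case (Suc l)
  then show ?case using M
    unfolding change_op.simps
    by (intro commutant_add commutant_mult increments_in_commutant slot_in_commutant slot_ops_subset) auto
qed

lemma noise_in_commutant_slot:
  assumes "i \<noteq> j" "i \<le> k" "j \<le> k"
  shows "noise j \<in> commutant n (slot_ops k i)"
  using assms by (intro commutant_add increments_in_commutant slot_ops_subset) auto

lemma noise_in_commutant_quad_proj: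
  assumes "i \<le> k" "j \<le> k"
  shows "noise j \<in> commutant n {slot k i (quad_proj b)}"
proof (cases "i = j")
  case True
  have "quad_proj b * quadrature = quadrature * quad_proj b" by (simp add: quadrature_quad_proj)
  then have "slot k i quadrature \<in> commutant n {slot k i (quad_proj b)}"
    using assms by (simp add: commutant_def flip: slot_mult)
  then show ?thesis unfolding noise_eq[OF assms(2)] using assms True by (intro commutant_smult) auto
next
  case False
  show ?thesis
    by (rule commutant_mono[OF noise_in_commutant_slot[of i j]]) (use assms False in auto)
qed

text \<open>The field enters \<open>V l\<close> only through the sums \<open>dA + dAstar\<close>,
  which are multiples of quadratures. This is the gain from using the coefficient \<open>Mp\<close>
  for both increments.\<close>

lemma V_in_commutant_quad_proj:
  assumes "l \<le> k" "1 \<le> i" "i \<le> k"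
  shows "V l \<in> commutant n {slot k i (quad_proj b)}"
  using assms(1)
proof (induction l)
  case 0
  then show ?case using assms by (simp add: commutant_one)
next
  case (Suc l)
  have s: "{slot k i (quad_proj b)} \<subseteq> carrier_mat n n" using assms by simp
  have "sys k A \<in> commutant n {slot k i (quad_proj b)}" if "A \<in> M2" for A
    by (rule commutant_mono[OF slot_in_commutant[of _ i]]) (use that assms in auto)
  moreover have "dt k lam (Suc l) \<in> commutant n {slot k i (quad_proj b)}"
    by (simp add: dt_def commutant_smult[OF s] commutant_one[OF s])
  ultimately show ?case using Suc M assms s
    unfolding change_op.simps
    by (intro commutant_add commutant_mult noise_in_commutant_quad_proj) auto
qed

lemma record_proj_commutes:
  assumes bs: "length bs \<le> k" and Z: "\<And>i b. 1 \<le> i \<Longrightarrow> i \<le> length bs \<Longrightarrow> Z \<in> commutant n {slot k i (quad_proj b)}"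
    and Zc: "Z \<in> carrier_mat n n"
  shows "record_proj k bs * Z = Z * record_proj k bs"
proof -
  have "record_proj k bs \<in> commutant n {Z}"
  proof (rule record_proj_in_commutant[OF bs])
    show "slot k i (quad_proj b) \<in> commutant n {Z}" if "1 \<le> i" "i \<le> length bs" for i b
      by (rule commutant_sym[OF Z[OF that]]) (use that bs in simp)
  qed (use Zc in simp)
  then show ?thesis by (auto dest: commutantD)
qed

lemma record_proj_sys:
  "length bs \<le> k \<Longrightarrow> A \<in> M2 \<Longrightarrow> record_proj k bs * sys k A = sys k A * record_proj k bs"
  using record_proj_in_commutant_slot[of bs k 0] by (auto dest!: commutantD)

lemma record_proj_noise:
  "length bs \<le> k \<Longrightarrow> i \<le> k \<Longrightarrow> record_proj k bs * noise i = noise i * record_proj k bs"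
  by (rule record_proj_commutes) (auto intro: noise_in_commutant_quad_proj)

lemma record_proj_V:
  "length bs \<le> k \<Longrightarrow> l \<le> k \<Longrightarrow> record_proj k bs * V l = V l * record_proj k bs"
  by (rule record_proj_commutes) (auto intro: V_in_commutant_quad_proj)

lemma noise_mult_record_proj_Cons:
  assumes "Suc (length bs) \<le> k"
  shows "noise (Suc (length bs)) * record_proj k (b # bs) = (lam * outcome b) \<cdot>\<^sub>m record_proj k (b # bs)"
proof -
  let ?i = "Suc (length bs)"
  have "noise ?i * record_proj k (b # bs) = (noise ?i * record_proj k bs) * slot k ?i (quad_proj b)"
    using assms by (simp add: mult_assoc_dim)
  also have "\<dots> = record_proj k bs * (noise ?i * slot k ?i (quad_proj b))"
    using assms by (simp add: mult_assoc_dim flip: record_proj_noise)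
  also have "noise ?i * slot k ?i (quad_proj b) = (lam * outcome b) \<cdot>\<^sub>m slot k ?i (quad_proj b)"
    unfolding noise_eq[OF assms] using assms
    by (simp add: smult_mult_dim quadrature_quad_proj slot_smult smult_smult_mat flip: slot_mult)
  finally show ?thesis using assms by (simp add: mult_smult_dim)
qed

text \<open>Each outcome of the record replaces the noise increment of its slot by the eigenvalue
  \<open>lam * outcome b\<close>, which turns a factor of \<open>V\<close> into
  \<open>kraus\<close>. Later factors stand further left in both products.\<close>

lemma V_mult_record_proj:
  "length bs \<le> k \<Longrightarrow> V (length bs) * record_proj k bs = sys k (K bs) * record_proj k bs"
proof (induction bs)
  case Nil
  then show ?case by (simp add: slot_one)
next
  case (Cons b bs)
  let ?l = "length bs" and ?r = "record_proj k (b # bs)" and ?h = "slot k (Suc (length bs)) (quad_proj b)"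
  have l: "?l \<le> k" "Suc ?l \<le> k" using Cons.prems by auto
  note IH = Cons.IH[OF l(1)]
  have Kc: "K bs \<in> M2" using M by simp
  have r: "?r \<in> carrier_mat n n" using l by simp
  have rd: "dim_row ?r = n" "dim_col ?r = n" using r by auto
  have 1: "V ?l * ?r = sys k (K bs) * ?r"
  proof -
    have "V ?l * ?r = (V ?l * record_proj k bs) * ?h" using l by (simp add: mult_assoc_dim)
    also have "\<dots> = sys k (K bs) * ?r" unfolding IH using l Kc by (simp add: mult_assoc_dim)
    finally show ?thesis .
  qed
  have 2: "noise (Suc ?l) * (sys k (K bs) * ?r) = (lam * outcome b) \<cdot>\<^sub>m (sys k (K bs) * ?r)"
  proof -
    have c: "noise (Suc ?l) * sys k (K bs) = sys k (K bs) * noise (Suc ?l)"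
      using noise_in_commutant_slot[of 0 "Suc ?l", THEN commutantD, of "sys k (K bs)"] l Kc by simp
    have "noise (Suc ?l) * (sys k (K bs) * ?r) = (noise (Suc ?l) * sys k (K bs)) * ?r"
      using l Kc rd by (simp add: mult_assoc_dim del: record_proj.simps)
    also have "\<dots> = sys k (K bs) * (noise (Suc ?l) * ?r)"
      unfolding c using l Kc rd by (simp add: mult_assoc_dim del: record_proj.simps)
    finally show ?thesis
      unfolding noise_mult_record_proj_Cons[OF l(2)] using l Kc rd
      by (simp add: mult_smult_dim del: record_proj.simps)
  qed
  have "V (Suc ?l) * ?r = V ?l * ?r + (sys k Mp * (noise (Suc ?l) * (V ?l * ?r)) + sys k Mo * (dt k lam (Suc ?l) * (V ?l * ?r)))"
    using l M rd by (simp add: mult_assoc_dim add_mult_dim del: record_proj.simps)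
  also have "\<dots> = sys k (kraus lam Mp Mo b) * (sys k (K bs) * ?r)"
    unfolding 1 2 using l M Kc rd
    by (simp add: kraus_def dt_def slot_add slot_smult slot_one mat_ring_dim del: record_proj.simps)
  also have "\<dots> = sys k (K (b # bs)) * ?r"
    using M Kc rd by (simp add: slot_mult mult_assoc_dim del: record_proj.simps)
  finally show ?case by simp
qed

text \<open>In slot \<open>Suc l\<close>, \<open>sigma_minus\<close> passes \<open>V l\<close>,
  which lives on earlier slots, and annihilates the vacuum. This removes the terms with
  \<open>Mpm\<close> and \<open>Mm\<close> from the interaction, and equally the \<open>dA\<close>
  term from the increment of \<open>V\<close>.\<close>

lemma U_mult_vac_embed: "l \<le> k \<Longrightarrow> U l * J = V l * J"
proof (induction l)
  case 0
  then show ?case by simp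
next
  case (Suc l)
  have l: "l \<le> k" "Suc l \<le> k" using Suc.prems by auto
  note IH = Suc.IH[OF l(1)]
  have "slot k (Suc l) sigma_minus * V l = V l * slot k (Suc l) sigma_minus"
    using V_in_commutant[of l "Suc l", THEN commutantD, of "slot k (Suc l) sigma_minus"] l by simp
  moreover have "slot k (Suc l) sigma_minus * (V l * J) = (slot k (Suc l) sigma_minus * V l) * J"
    using l by (simp add: mult_assoc_dim)
  ultimately have "slot k (Suc l) sigma_minus * (V l * J) = V l * (slot k (Suc l) sigma_minus * J)"
    using l by (simp add: mult_assoc_dim)
  then have s0: "slot k (Suc l) sigma_minus * (V l * J) = 0\<^sub>m n 2"
    using l by (simp add: slot_sigma_minus_vac_embed right_mult_zero_mat[OF V_carrier])
  have A0: "dA k lam (Suc l) * (V l * J) = 0\<^sub>m n 2"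
    unfolding dA_def using l by (simp add: smult_mult_dim s0)
  have L0: "dLambda k (Suc l) * (V l * J) = 0\<^sub>m n 2"
    unfolding dLambda_def using l
    by (simp add: slot_mult mult_assoc_dim s0 right_mult_zero_mat[OF slot_carrier])
  have z: "0\<^sub>m n 2 + A = A" "A + 0\<^sub>m n 2 = A" if "dim_row A = n" "dim_col A = 2" for A :: "complex mat"
    using that by (auto intro!: eq_matI)
  have "U (Suc l) * J = step (Suc l) * (V l * J)"
    using l step_unitary(1)[of "Suc l"] by (simp add: mult_assoc_dim flip: IH)
  also have "\<dots> = V l * J + (sys k Mp * (dAstar k lam (Suc l) * (V l * J)) + sys k Mo * (dt k lam (Suc l) * (V l * J)))"
    unfolding step_eq[of "Suc l", OF _ l(2), simplified] using l M
    by (simp add: mult_assoc_dim add_mult_dim one_mult_dim L0 A0 right_mult_zero_mat[OF slot_carrier] z)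
  also have "\<dots> = V (Suc l) * J"
    using l M by (simp add: mult_assoc_dim add_mult_dim A0 z)
  finally show ?case .
qed

lemma heisenberg_V_mult_record_proj:
  assumes l: "length bs \<le> k" and X: "X \<in> M2"
  shows "heisenberg (V (length bs)) (sys k X) * record_proj k bs
    = sys k (heisenberg (K bs) X) * record_proj k bs"
proof -
  let ?V = "V (length bs)" and ?r = "record_proj k bs"
  have Kc: "K bs \<in> M2" using M by simp
  have idem: "?r * ?r = ?r" using l by (simp add: record_proj_orthogonal)
  have Vr: "mat_adjoint ?V * ?r = sys k (mat_adjoint (K bs)) * ?r"
  proof -
    have "mat_adjoint (?r * ?V) = mat_adjoint (sys k (K bs) * ?r)"
      unfolding record_proj_V[OF l l] V_mult_record_proj[OF l] ..
    also have "sys k (K bs) * ?r = ?r * sys k (K bs)"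
      using l Kc by (simp add: record_proj_sys)
    finally show ?thesis
      using l Kc by (simp add: mat_adjoint_mult record_proj_adjoint slot_adjoint)
  qed
  have "heisenberg ?V (sys k X) * ?r = mat_adjoint ?V * (sys k X * (sys k (K bs) * ?r))"
    using l X by (simp add: heisenberg_def mult_assoc_dim V_mult_record_proj)
  \<comment> \<open>The projection is doubled: one copy stays on the right, the other moves left
    past the system operators to meet the adjoint of \<open>V\<close>.\<close>
  also have "\<dots> = mat_adjoint ?V * (sys k X * ((sys k (K bs) * ?r) * ?r))"
    using l Kc by (simp add: mult_assoc_dim idem)
  also have "\<dots> = (mat_adjoint ?V * ?r) * (sys k X * (sys k (K bs) * ?r))"
  proof -
    have c: "sys k A * (?r * Z) = ?r * (sys k A * Z)" if "A \<in> M2" "dim_row Z = n" for A Z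
    proof -
      have "sys k A * (?r * Z) = (sys k A * ?r) * Z" using that l by (simp add: mult_assoc_dim)
      also have "\<dots> = ?r * (sys k A * Z)"
        using that l by (simp add: mult_assoc_dim flip: record_proj_sys)
      finally show ?thesis .
    qed
    show ?thesis using l X Kc by (simp add: mult_assoc_dim c)
  qed
  also have "\<dots> = sys k (heisenberg (K bs) X) * ?r"
  proof -
    have "(sys k (mat_adjoint (K bs)) * ?r) * (sys k X * (sys k (K bs) * ?r))
        = sys k (mat_adjoint (K bs)) * ((?r * sys k (X * K bs)) * ?r)"
      using l X Kc by (simp add: mult_assoc_dim slot_mult)
    also have "\<dots> = sys k (mat_adjoint (K bs)) * (sys k (X * K bs) * ?r)"
      using l X Kc by (simp add: record_proj_sys mult_assoc_dim idem)
    finally show ?thesis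
      using l X Kc by (simp add: Vr heisenberg_def slot_mult mult_assoc_dim)
  qed
  finally show ?thesis .
qed

text \<open>The product state evaluates \<open>heisenberg W Z\<close> through \<open>W * J\<close>
  alone.\<close>

lemma heisenberg_U_V_state:
  assumes l: "l \<le> k" and Z: "Z \<in> ops k"
  shows "P (heisenberg (U l) Z) = P (heisenberg (V l) Z)"
proof -
  have eq: "compress k (heisenberg W Z) = mat_adjoint (W * J) * (Z * (W * J))" if "W \<in> ops k" for W
    using that Z by (simp add: compress_def heisenberg_def mat_adjoint_mult mult_assoc_dim)
  show ?thesis
    using l Z by (simp add: prod_state_eq eq U_mult_vac_embed)
qed

section \<open>Joint expectations of system operators and records\<close>

lemma state_smult: "A \<in> M2 \<Longrightarrow> \<rho> (c \<cdot>\<^sub>m A) = c * \<rho> A"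
  and state_add: "A \<in> M2 \<Longrightarrow> B \<in> M2 \<Longrightarrow> \<rho> (A + B) = \<rho> A + \<rho> B"
  and state_one: "\<rho> (1\<^sub>m 2) = 1"
  using state by (auto simp: is_state_def)

lemma state_V_record_proj:
  assumes l: "length bs \<le> k" and X: "X \<in> M2"
  shows "P (heisenberg (V (length bs)) (sys k X) * record_proj k bs) = (1 / 2) ^ length bs * weight bs X"
proof -
  have "heisenberg (K bs) X \<in> M2" using M X by simp
  then show ?thesis using l
    by (simp add: heisenberg_V_mult_record_proj[OF l X] prod_state_eq compress_sys_mult
        compress_record_proj mult_smult_dim state_smult mult_one_dim)
qed

lemma state_record_proj:
  "length bs \<le> k \<Longrightarrow> P (record_proj k bs) = (1 / 2) ^ length bs"
  by (simp add: prod_state_eq compress_record_proj state_smult state_one)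

text \<open>As \<open>U\<close> need not commute with the projection, the product is first formed
  inside the conjugation. Once \<open>U\<close> is replaced by \<open>V\<close>, the projection can
  be taken out again.\<close>

lemma state_U_record_proj:
  assumes l: "length bs \<le> k" and X: "X \<in> M2"
  shows "P (heisenberg (U (length bs)) (sys k X) * heisenberg (U (length bs)) (record_proj k bs))
    = (1 / 2) ^ length bs * weight bs X"
proof -
  let ?U = "U (length bs)" and ?V = "V (length bs)" and ?r = "record_proj k bs"
  have "heisenberg ?U (sys k X) * heisenberg ?U ?r = heisenberg ?U (sys k X * ?r)"
    using l X U_unitary[OF l] by (intro heisenberg_mult) auto
  then have "P (heisenberg ?U (sys k X) * heisenberg ?U ?r) = P (heisenberg ?V (sys k X * ?r))"
    using l X by (simp add: heisenberg_U_V_state)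
  also have "heisenberg ?V (sys k X * ?r) = heisenberg ?V (sys k X) * ?r"
    using l X by (simp add: heisenberg_def mult_assoc_dim record_proj_V)
  finally show ?thesis using state_V_record_proj[OF l X] by simp
qed

lemma state_U_record_proj_one:
  assumes l: "length bs \<le> k"
  shows "P (heisenberg (U (length bs)) (record_proj k bs)) = (1 / 2) ^ length bs * weight bs (1\<^sub>m 2)"
  using state_U_record_proj[OF l, of "1\<^sub>m 2"] l U_unitary[OF l]
  by (simp add: slot_one heisenberg_one one_mult_dim heisenberg_def mult_one_dim)

text \<open>\<open>K bs\<close> is a null vector of \<rho>, so every product with
  \<open>K bs\<close> on the right has expectation zero. A quotient of weights with zero denominator
  therefore has zero numerator.\<close>

lemma weight_eq_zero:
  assumes "weight bs (1\<^sub>m 2) = 0" and X: "X \<in> M2"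
  shows "weight bs X = 0"
proof -
  have Kc: "K bs \<in> M2" using M by simp
  have "\<rho> (mat_adjoint (K bs) * K bs) = 0"
    using assms(1) Kc by (simp add: heisenberg_def mult_one_dim)
  from state_null_left[OF state Kc _ this, of "mat_adjoint (K bs) * X"]
  have "\<rho> ((mat_adjoint (K bs) * X) * K bs) = 0"
    using X Kc by simp
  then show ?thesis by (simp add: heisenberg_def)
qed

text \<open>The latest Kraus matrix is leftmost in \<open>K (b # bs)\<close> and hence next to
  \<open>X\<close>, so \<open>kraus_conj\<close> applies inside the conjugation by the older
  ones.\<close>

lemma weight_Cons:
  assumes X: "X \<in> M2"
  shows "weight (b # bs) X = weight bs X
    + (complex_of_real (lam\<^sup>2) * weight bs (lindblad lam Mp Mo X) + lam * outcome b * weight bs (jump lam Mp Mo X))"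
proof -
  have Kc: "K bs \<in> M2" using M by simp
  have c: "lindblad lam Mp Mo X \<in> M2" "jump lam Mp Mo X \<in> M2"
    using M X by (simp_all add: lindblad_def jump_def)
  have "heisenberg (K (b # bs)) X = heisenberg (K bs) (heisenberg (kraus lam Mp Mo b) X)"
  proof -
    have "dim_row (kraus lam Mp Mo b) = 2" "dim_col (kraus lam Mp Mo b) = 2"
      using kraus_carrier[of Mp Mo lam b] M by (metis carrier_matD)+
    then show ?thesis
      using X carrier_matD[OF Kc] by (simp add: heisenberg_def mat_adjoint_mult mult_assoc_dim)
  qed
  then show ?thesis
    using M X Kc c
    by (simp add: kraus_conj heisenberg_add heisenberg_smult state_add state_smult)
qed

text \<open>With only two eigenvalues, a spectral projection is an affine function of its
  quadrature, and the quadrature is the increment divided by \<open>lam\<close>.\<close>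

lemma slot_quad_proj_in_star_alg:
  assumes "1 \<le> i" "i \<le> l" "l \<le> k"
  shows "slot k i (quad_proj b) \<in> star_alg n ((\<lambda>i. noise i) ` {1..l})"
proof -
  have "slot k i (quad_proj b) = (1 / 2) \<cdot>\<^sub>m (1\<^sub>m n + (outcome b / lam) \<cdot>\<^sub>m noise i)"
  proof -
    have "(outcome b / lam) \<cdot>\<^sub>m noise i = outcome b \<cdot>\<^sub>m slot k i quadrature"
      using assms lam_nonzero by (simp add: noise_eq smult_smult_mat)
    then show ?thesis
      using assms by (simp add: quad_proj_eq slot_smult slot_add slot_one)
  qed
  moreover have "noise i \<in> star_alg n ((\<lambda>i. noise i) ` {1..l})"
    using assms by (intro star_alg.gen) auto
  ultimately show ?thesis
    by (simp only:) (rule star_alg.smult, rule star_alg.add, rule star_alg.one, rule star_alg.smult)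
qed

lemma record_proj_in_star_alg:
  "length bs \<le> l \<Longrightarrow> l \<le> k \<Longrightarrow> record_proj k bs \<in> star_alg n ((\<lambda>i. noise i) ` {1..l})"
proof (induction bs)
  case (Cons b bs)
  then have "slot k (Suc (length bs)) (quad_proj b) \<in> star_alg n ((\<lambda>i. noise i) ` {1..l})"
    by (intro slot_quad_proj_in_star_alg) auto
  then show ?case using Cons by (auto intro: star_alg.mult)
qed (simp add: star_alg.one)

lemma noise_eigenvalue:
  "length bs \<le> k \<Longrightarrow> 1 \<le> i \<Longrightarrow> i \<le> length bs \<Longrightarrow> \<exists>c. noise i * record_proj k bs = c \<cdot>\<^sub>m record_proj k bs"
proof (induction bs)
  case (Cons b bs)
  show ?case
  proof (cases "i = length (b # bs)")
    case True
    then show ?thesis using Cons.prems noise_mult_record_proj_Cons[of bs b] by auto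
  next
    case False
    then obtain c where "noise i * record_proj k bs = c \<cdot>\<^sub>m record_proj k bs"
      using Cons by auto
    moreover have "noise i * record_proj k (b # bs) = (noise i * record_proj k bs) * slot k (Suc (length bs)) (quad_proj b)"
      using Cons.prems by (simp add: mult_assoc_dim)
    ultimately have "noise i * record_proj k (b # bs) = c \<cdot>\<^sub>m record_proj k (b # bs)"
      using Cons.prems by (simp add: smult_mult_dim)
    then show ?thesis ..
  qed
qed simp

lemma noise_in_span:
  assumes "1 \<le> i" "i \<le> l" "l \<le> k"
  shows "noise i \<in> range (\<lambda>c. lin_comb n (records l) c (record_proj k))"
proof -
  have "\<forall>bs. \<exists>c. bs \<in> records l \<longrightarrow> noise i * record_proj k bs = c \<cdot>\<^sub>m record_proj k bs"
    using noise_eigenvalue assms by auto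
  then obtain c where "\<forall>bs\<in>records l. noise i * record_proj k bs = c bs \<cdot>\<^sub>m record_proj k bs"
    by metis
  then have "noise i = lin_comb n (records l) c (record_proj k)"
    using assms by (intro projection_family.eq_lin_combI[OF record_proj_family]) auto
  then show ?thesis by blast
qed

lemma noise_star_alg:
  assumes l: "l \<le> k"
  shows "star_alg n ((\<lambda>i. noise i) ` {1..l}) = range (\<lambda>c. lin_comb n (records l) c (record_proj k))"
  using l by (intro projection_family.star_alg_eq_span[OF record_proj_family]) (auto intro: noise_in_span record_proj_in_star_alg simp del: One_nat_def)

lemma heisenberg_U_Suc:
  assumes l: "Suc l \<le> k" and Z: "step (Suc l) \<in> commutant n {Z}" "Z \<in> carrier_mat n n"
  shows "heisenberg (U (Suc l)) Z = heisenberg (U l) Z"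
proof -
  let ?M = "step (Suc l)"
  have u: "?M \<in> carrier_mat n n" "mat_adjoint ?M * ?M = 1\<^sub>m n"
    using step_unitary[of "Suc l"] l by simp_all
  have "heisenberg (U (Suc l)) Z = mat_adjoint (U l) * (mat_adjoint ?M * ((Z * ?M) * U l))"
    using l Z(2) u(1) by (simp add: heisenberg_def mat_adjoint_mult mult_assoc_dim)
  also have "Z * ?M = ?M * Z" using Z(1) by (simp add: commutant_def)
  also have "mat_adjoint (U l) * (mat_adjoint ?M * ((?M * Z) * U l)) = mat_adjoint (U l) * ((mat_adjoint ?M * ?M) * (Z * U l))"
    using l Z(2) u(1) by (simp add: mult_assoc_dim)
  also have "\<dots> = heisenberg (U l) Z"
    unfolding u(2) using l Z(2) by (simp add: heisenberg_def mult_assoc_dim one_mult_dim)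
  finally show ?thesis .
qed

text \<open>Self-nondemolition: interactions after time \<open>i\<close> act on the system and on
  other slots, hence commute with this increment. All observations up to time \<open>l\<close> are
  thus conjugates by the single unitary \<open>U l\<close>.\<close>

lemma heisenberg_noise:
  assumes "1 \<le> i" "i \<le> l" "l \<le> k"
  shows "heisenberg (U l) (noise i) = heisenberg (U i) (noise i)"
  using assms(2,3)
proof (induction l rule: dec_induct)
  case (step m)
  have "noise i \<in> slot_ops k i"
    using assms by (simp add: noise_eq flip: slot_smult)
  then have "interaction k lam L1 L2 L3 (Suc m) \<in> commutant n {noise i}"
    using step.hyps step.prems assms by (intro commutant_mono[OF step_in_commutant[of "Suc m" i]]) auto
  then have "heisenberg (U (Suc m)) (noise i) = heisenberg (U m) (noise i)"
    using step.hyps step.prems assms by (intro heisenberg_U_Suc) auto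
  then show ?case using step by simp
qed simp

lemma heisenberg_record_proj_Suc:
  assumes "length bs \<le> l" "Suc l \<le> k"
  shows "heisenberg (U (Suc l)) (record_proj k bs) = heisenberg (U l) (record_proj k bs)"
proof (rule heisenberg_U_Suc)
  have "record_proj k bs \<in> commutant n {step (Suc l)}"
  proof (rule record_proj_in_commutant)
    show "slot k i (quad_proj b) \<in> commutant n {step (Suc l)}" if "1 \<le> i" "i \<le> length bs" for i b
    proof (rule commutant_sym)
      show "step (Suc l) \<in> commutant n {slot k i (quad_proj b)}"
        using that assms by (intro commutant_mono[OF step_in_commutant[of "Suc l" i]]) auto
      show "slot k i (quad_proj b) \<in> carrier_mat n n" using that assms by simp
    qed
  qed (use assms step_unitary(1)[of "Suc l"] in auto)
  then show "step (Suc l) \<in> commutant n {record_proj k bs}"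
    by (rule commutant_sym) (use assms step_unitary(1)[of "Suc l"] in auto)
qed (use assms in auto)

abbreviation "obs_proj l bs \<equiv> heisenberg (U l) (record_proj k bs)"

lemma observation_family:
  assumes l: "l \<le> k"
  shows "projection_family n (records l) (obs_proj l)"
  using U_unitary[OF l] l
  by (intro projection_family.heisenberg_projection_family[OF record_proj_family]) auto

lemma observation_star_alg:
  assumes l: "l \<le> k"
  shows "star_alg n ((\<lambda>i. heisenberg (U i) (noise i)) ` {1..l}) = range (\<lambda>c. lin_comb n (records l) c (obs_proj l))"
proof -
  have img: "(\<lambda>i. heisenberg (U i) (noise i)) ` {1..l} = heisenberg (U l) ` (\<lambda>i. noise i) ` {1..l}"
    unfolding image_image by (rule image_cong) (simp_all add: heisenberg_noise[OF _ _ l])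
  show ?thesis
  proof (rule projection_family.star_alg_eq_span[OF observation_family[OF l]])
    show "(\<lambda>i. heisenberg (U i) (noise i)) ` {1..l} \<subseteq> range (\<lambda>c. lin_comb n (records l) c (obs_proj l))"
    proof
      fix A assume "A \<in> (\<lambda>i. heisenberg (U i) (noise i)) ` {1..l}"
      then obtain i where i: "1 \<le> i" "i \<le> l" and A: "A = heisenberg (U l) (noise i)"
        unfolding img by auto
      obtain c where "noise i = lin_comb n (records l) c (record_proj k)"
        using noise_in_span[OF i l] by blast
      then have "A = lin_comb n (records l) c (obs_proj l)"
        unfolding A by (simp only:) (rule heisenberg_lin_comb; use l in auto)
      then show "A \<in> range (\<lambda>c. lin_comb n (records l) c (obs_proj l))" by blast
    qed
    show "obs_proj l ` records l \<subseteq> star_alg n ((\<lambda>i. heisenberg (U i) (noise i)) ` {1..l})"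
    proof
      fix A assume "A \<in> obs_proj l ` records l"
      then obtain bs where bs: "length bs = l" and A: "A = obs_proj l bs" by auto
      show "A \<in> star_alg n ((\<lambda>i. heisenberg (U i) (noise i)) ` {1..l})"
        unfolding img A
      proof (rule star_alg_heisenberg)
        show "record_proj k bs \<in> star_alg n ((\<lambda>i. noise i) ` {1..l})"
          using record_proj_in_star_alg bs l by simp
      qed (use l U_unitary[OF l] in auto)
    qed
  qed
qed

abbreviation "estimate l X \<equiv> lin_comb n (records l) (\<lambda>bs. weight bs X) (record_proj k)"

text \<open>Every record projection has nonzero state value, so each coefficient is determined and
  the version is unique as a matrix.\<close>

lemma cond_exp_noise_iff:
  assumes l: "l \<le> k" and X: "X \<in> M2"
  shows "is_cond_exp n P (star_alg n ((\<lambda>i. noise i) ` {1..l})) (heisenberg (V l) (sys k X)) E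
    \<longleftrightarrow> E = estimate l X"
proof -
  have comm: "heisenberg (V l) (sys k X) \<in> commutant n (range (\<lambda>c. lin_comb n (records l) c (record_proj k)))"
  proof (rule projection_family.commutant_spanI[OF record_proj_family[OF l]])
    fix bs assume "bs \<in> records l"
    then have bs: "length bs \<le> k" using l by simp
    have "record_proj k bs * mat_adjoint (V l) = mat_adjoint (V l) * record_proj k bs"
    proof -
      have "mat_adjoint (V l * record_proj k bs) = mat_adjoint (record_proj k bs * V l)"
        by (simp add: record_proj_V[OF bs l])
      then show ?thesis using bs l by (simp add: mat_adjoint_mult record_proj_adjoint)
    qed
    then show "record_proj k bs * heisenberg (V l) (sys k X) = heisenberg (V l) (sys k X) * record_proj k bs"
      using record_proj_V[OF bs l] record_proj_sys[OF bs X] bs l X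
      unfolding heisenberg_def by (smt (verit) mult_assoc_dim dim_V dim_record_proj dim_slot index_mult_mat(2,3) dim_mat_adjoint le0)
  qed (use l X in simp)
  have "(\<forall>bs\<in>records l. c bs * P (record_proj k bs) = P (heisenberg (V l) (sys k X) * record_proj k bs))
    \<longleftrightarrow> (\<forall>bs\<in>records l. c bs = weight bs X)" for c
    using state_V_record_proj[OF _ X] state_record_proj l by auto
  then show ?thesis
    unfolding noise_star_alg[OF l] projection_family.is_cond_exp_iff[OF record_proj_family[OF l] prod_state_linear[OF state] comm]
    by (auto intro: lin_comb_cong)
qed

text \<open>The common factor \<open>(1 / 2) ^ l\<close> cancels. The equation for
  \<open>c bs\<close> is kept in multiplied form because the probability of \<open>bs\<close> may
  vanish.\<close>

lemma cond_exp_observation_iff: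
  assumes l: "l \<le> k" and X: "X \<in> M2"
  shows "is_cond_exp n P (star_alg n ((\<lambda>i. heisenberg (U i) (noise i)) ` {1..l})) (heisenberg (U l) (sys k X)) E
    \<longleftrightarrow> (\<exists>c. E = lin_comb n (records l) c (obs_proj l)
      \<and> (\<forall>bs\<in>records l. c bs * weight bs (1\<^sub>m 2) = weight bs X))"
proof -
  have comm: "heisenberg (U l) (sys k X) \<in> commutant n (range (\<lambda>c. lin_comb n (records l) c (obs_proj l)))"
  proof (rule projection_family.commutant_spanI[OF observation_family[OF l]])
    fix bs assume "bs \<in> records l"
    then have bs: "length bs \<le> k" using l by simp
    then show "obs_proj l bs * heisenberg (U l) (sys k X) = heisenberg (U l) (sys k X) * obs_proj l bs"
      using l X
      by (simp add: heisenberg_mult[OF U_carrier[OF l] conjunct2[OF U_unitary[OF l]]] record_proj_sys)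
  qed (use l X in simp)
  have "(\<forall>bs\<in>records l. c bs * P (obs_proj l bs) = P (heisenberg (U l) (sys k X) * obs_proj l bs))
    \<longleftrightarrow> (\<forall>bs\<in>records l. c bs * weight bs (1\<^sub>m 2) = weight bs X)" for c
    using state_U_record_proj[OF _ X] state_U_record_proj_one l by (auto simp: algebra_simps)
  then show ?thesis
    unfolding observation_star_alg[OF l] projection_family.is_cond_exp_iff[OF observation_family[OF l] prod_state_linear[OF state] comm]
    by simp
qed

text \<open>On the record \<open>b # bs\<close> the new increment is the number
  \<open>lam * outcome b\<close>, and the identity reduces to \<open>weight_Cons\<close>.\<close>

lemma estimate_Suc:
  assumes l: "Suc l \<le> k" and X: "X \<in> M2"
  shows "estimate (Suc l) X = estimate l X
    + (complex_of_real (lam\<^sup>2) \<cdot>\<^sub>m estimate l (lindblad lam Mp Mo X)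
      + estimate l (jump lam Mp Mo X) * noise (Suc l))"
proof (rule projection_family.eq_lin_combI[OF record_proj_family[OF l], symmetric])
  fix bs' assume "bs' \<in> records (Suc l)"
  then obtain b bs where bs': "bs' = b # bs" and bs: "length bs = l" by (cases bs') auto
  let ?r = "record_proj k (b # bs)"
  have lk: "l \<le> k" using l by simp
  have rd: "dim_row ?r = n" "dim_col ?r = n"
    using dim_record_proj[of "b # bs" k] bs l by auto
  \<comment> \<open>A function of the shorter record sees only the tail of the longer one, because
    \<open>?r\<close> lies below \<open>record_proj k bs\<close>.\<close>
  have est: "lin_comb n (records l) c (record_proj k) * ?r = c bs \<cdot>\<^sub>m ?r" for c
  proof -
    have "lin_comb n (records l) c (record_proj k) * ?r
        = (lin_comb n (records l) c (record_proj k) * record_proj k bs) * slot k (Suc l) (quad_proj b)"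
      using bs l by (simp add: mult_assoc_dim)
    then show ?thesis
      using bs l projection_family.lin_comb_mult_proj[OF record_proj_family[OF lk], of bs c] by (simp add: smult_mult_dim)
  qed
  have noise: "noise (Suc l) * ?r = (lam * outcome b) \<cdot>\<^sub>m ?r"
    using noise_mult_record_proj_Cons[of bs b] bs l by simp
  have "(estimate l X + (complex_of_real (lam\<^sup>2) \<cdot>\<^sub>m estimate l (lindblad lam Mp Mo X)
      + estimate l (jump lam Mp Mo X) * noise (Suc l))) * ?r
    = weight bs X \<cdot>\<^sub>m ?r + (complex_of_real (lam\<^sup>2) \<cdot>\<^sub>m (weight bs (lindblad lam Mp Mo X) \<cdot>\<^sub>m ?r)
      + estimate l (jump lam Mp Mo X) * (noise (Suc l) * ?r))"
    using l rd by (simp add: add_mult_dim smult_mult_dim mult_assoc_dim est del: record_proj.simps)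
  also have "\<dots> = weight (b # bs) X \<cdot>\<^sub>m ?r"
    unfolding noise weight_Cons[OF X] using rd
    by (simp add: mult_smult_dim est smult_smult_mat del: record_proj.simps kraus_prod.simps)
      (rule eq_matI; simp add: algebra_simps del: record_proj.simps kraus_prod.simps)
  finally show "(estimate l X + (complex_of_real (lam\<^sup>2) \<cdot>\<^sub>m estimate l (lindblad lam Mp Mo X)
      + estimate l (jump lam Mp Mo X) * noise (Suc l))) * record_proj k bs' = weight bs' X \<cdot>\<^sub>m record_proj k bs'"
    unfolding bs' .
qed (use l in simp)

lemma heisenberg_estimate:
  "l \<le> k \<Longrightarrow> heisenberg (U l) (estimate l X) = lin_comb n (records l) (\<lambda>bs. weight bs X) (obs_proj l)"
  by (rule heisenberg_lin_comb) auto

text \<open>The next interaction leaves functions of earlier slots alone, so the whole recursion can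
  be conjugated by \<open>U (Suc l)\<close>.\<close>

lemma heisenberg_estimate_Suc:
  assumes "Suc l \<le> k"
  shows "heisenberg (U (Suc l)) (estimate l X) = heisenberg (U l) (estimate l X)"
proof -
  have "heisenberg (U (Suc l)) (estimate l X) = lin_comb n (records l) (\<lambda>bs. weight bs X) (obs_proj (Suc l))"
    using assms U_carrier[OF assms] by (intro heisenberg_lin_comb) (auto simp del: evolution.simps)
  also have "\<dots> = heisenberg (U l) (estimate l X)"
    using assms by (subst heisenberg_estimate) (auto intro!: lin_comb_cong heisenberg_record_proj_Suc simp del: evolution.simps)
  finally show ?thesis .
qed

lemma filter_recursion:
  assumes l: "1 \<le> l" "l \<le> k" and X: "X \<in> M2"
  shows "heisenberg (U l) (estimate l X) - heisenberg (U (l - 1)) (estimate (l - 1) X) =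
    heisenberg (U (l - 1)) (estimate (l - 1) (lindblad lam Mp Mo X)) * dt k lam l
    + heisenberg (U (l - 1)) (estimate (l - 1) (jump lam Mp Mo X)) * heisenberg (U l) (noise l)"
proof -
  obtain m where m: "l = Suc m" using l by (cases l) auto
  have mk: "Suc m \<le> k" "m \<le> k" using l m by auto
  have Uc: "U (Suc m) \<in> carrier_mat n n" "U (Suc m) * mat_adjoint (U (Suc m)) = 1\<^sub>m n"
    using U_carrier[OF mk(1)] U_unitary[OF mk(1)] by auto
  note h = heisenberg_add[OF Uc(1)] heisenberg_smult[OF Uc(1)] heisenberg_mult[OF Uc, symmetric]
    heisenberg_estimate_Suc[OF mk(1)]
  have "heisenberg (U (Suc m)) (estimate (Suc m) X) = heisenberg (U m) (estimate m X)
    + (complex_of_real (lam\<^sup>2) \<cdot>\<^sub>m heisenberg (U m) (estimate m (lindblad lam Mp Mo X))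
      + heisenberg (U m) (estimate m (jump lam Mp Mo X)) * heisenberg (U (Suc m)) (noise (Suc m)))"
    unfolding estimate_Suc[OF mk(1) X] using mk by (simp add: h del: evolution.simps)
  moreover have "heisenberg (U m) A * dt k lam (Suc m) = complex_of_real (lam\<^sup>2) \<cdot>\<^sub>m heisenberg (U m) A"
    if "A \<in> carrier_mat n n" for A
    using carrier_matD[OF heisenberg_carrier[OF U_carrier[OF mk(2)] that]]
    by (simp add: dt_def mult_smult_dim mult_one_dim)
  moreover have "A + B - A = B" if "A \<in> carrier_mat n n" "B \<in> carrier_mat n n" for A B :: "complex mat"
    using that by (intro eq_matI) auto
  ultimately show ?thesis using mk Uc(1) unfolding m by (simp del: evolution.simps)
qed

lemma estimate_0:
  assumes X: "X \<in> M2"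
  shows "heisenberg (U 0) (estimate 0 X) = \<rho> X \<cdot>\<^sub>m 1\<^sub>m n"
proof -
  have "heisenberg (1\<^sub>m 2) X = X" using X by (simp add: heisenberg_def one_mult_dim mult_one_dim)
  then show ?thesis
    by (simp add: heisenberg_estimate)
      (rule eq_matI; simp add: lin_comb_def heisenberg_def one_mult_dim)
qed

subsection \<open>The filter\<close>

abbreviation "C_alg l \<equiv> star_alg n ((\<lambda>i. noise i) ` {1..l})"
abbreviation "Y_alg l \<equiv> star_alg n ((\<lambda>i. heisenberg (U i) (noise i)) ` {1..l})"
abbreviation "unnormalized l X \<equiv> lin_comb n (records l) (\<lambda>bs. weight bs X) (obs_proj l)"

lemma points_observation: "l \<le> k \<Longrightarrow> points n (Y_alg l) = obs_proj l ` records l"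
  by (simp only: observation_star_alg projection_family.points_span[OF observation_family])

lemma val_at_observation:
  "l \<le> k \<Longrightarrow> length bs = l \<Longrightarrow> val_at (lin_comb n (records l) c (obs_proj l)) (obs_proj l bs) = c bs"
  by (rule projection_family.val_at_lin_comb[OF observation_family]) auto

text \<open>The probability of a point is a multiple of the value of the denominator there, so the
  denominator vanishes only on null points.\<close>

lemma filter_as_nonzero:
  assumes "l \<le> k" shows "as_nonzero n P (Y_alg l) (unnormalized l (1\<^sub>m 2))"
  using assms state_U_record_proj_one
  unfolding as_nonzero_def points_observation[OF assms] by (auto simp: val_at_observation)

lemma is_quotient_filter_iff:
  assumes l: "l \<le> k"
  shows "is_quotient n (Y_alg l) (unnormalized l X) (unnormalized l (1\<^sub>m 2)) Q \<longleftrightarrow>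
    (\<exists>c. Q = lin_comb n (records l) c (obs_proj l) \<and>
      (\<forall>bs\<in>records l. weight bs (1\<^sub>m 2) \<noteq> 0 \<longrightarrow> c bs = weight bs X / weight bs (1\<^sub>m 2)))"
proof -
  have "Q \<in> Y_alg l \<longleftrightarrow> (\<exists>c. Q = lin_comb n (records l) c (obs_proj l))"
    unfolding observation_star_alg[OF l] by auto
  then show ?thesis
    using l unfolding is_quotient_def points_observation[OF l]
    by (auto simp: val_at_observation)
qed

text \<open>The coefficients agree wherever the denominator is nonzero, and the remaining points
  have probability zero.\<close>

lemma cond_exp_eq_quotient:
  assumes l: "l \<le> k" and X: "X \<in> M2"
    and Q: "is_quotient n (Y_alg l) (unnormalized l X) (unnormalized l (1\<^sub>m 2)) Q"
    and cond: "is_cond_exp n P (Y_alg l) (heisenberg (U l) (sys k X)) p"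
  shows "as_eq P p Q"
proof -
  obtain c where c: "Q = lin_comb n (records l) c (obs_proj l)"
    "\<And>bs. length bs = l \<Longrightarrow> weight bs (1\<^sub>m 2) \<noteq> 0 \<Longrightarrow> c bs = weight bs X / weight bs (1\<^sub>m 2)"
    using Q unfolding is_quotient_filter_iff[OF l] by auto
  obtain d where d: "p = lin_comb n (records l) d (obs_proj l)"
    "\<And>bs. length bs = l \<Longrightarrow> d bs * weight bs (1\<^sub>m 2) = weight bs X"
    using cond unfolding cond_exp_observation_iff[OF l X] by auto
  have "p - Q = lin_comb n (records l) (\<lambda>bs. d bs - c bs) (obs_proj l)"
    unfolding c(1) d(1) by (rule eq_matI) (auto simp: lin_comb_def left_diff_distrib sum_subtractf)
  then have "mat_adjoint (p - Q) * (p - Q)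
    = lin_comb n (records l) (\<lambda>bs. cnj (d bs - c bs) * (d bs - c bs)) (obs_proj l)"
    by (simp only: projection_family.lin_comb_adjoint_eq[OF observation_family[OF l]]
        projection_family.lin_comb_mult[OF observation_family[OF l]])
  then have "P (mat_adjoint (p - Q) * (p - Q))
    = (\<Sum>bs\<in>records l. cnj (d bs - c bs) * (d bs - c bs) * P (obs_proj l bs))"
    using l by (simp only:) (rule linear_functional_lin_comb[OF prod_state_linear[OF state]]; auto)
  also have "\<dots> = 0"
  proof (rule sum.neutral, rule ballI)
    fix bs assume "bs \<in> records l"
    then have bs: "length bs = l" by simp
    show "cnj (d bs - c bs) * (d bs - c bs) * P (obs_proj l bs) = 0"
    proof (cases "weight bs (1\<^sub>m 2) = 0")
      case True
      then show ?thesis using state_U_record_proj_one[of bs] bs l by simp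
    next
      case False
      then have "d bs = c bs"
        using c(2)[OF bs False] d(2)[OF bs] by (metis nonzero_mult_div_cancel_right)
      then show ?thesis by simp
    qed
  qed
  finally show ?thesis by (simp add: as_eq_def)
qed

lemma ex_cond_exp_observation:
  assumes l: "l \<le> k" and X: "X \<in> M2"
  shows "\<exists>p. is_cond_exp n P (Y_alg l) (heisenberg (U l) (sys k X)) p"
proof -
  \<comment> \<open>Division by zero gives zero, which is a correct value here because the numerator
    vanishes as well.\<close>
  have "weight bs X / weight bs (1\<^sub>m 2) * weight bs (1\<^sub>m 2) = weight bs X" for bs
  proof (cases "weight bs (1\<^sub>m 2) = 0")
    case True
    then show ?thesis using weight_eq_zero[OF True X] by (simp only: mult_zero_right)
  next
    case False
    then show ?thesis by simp
  qed
  then show ?thesis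
    unfolding cond_exp_observation_iff[OF l X]
    by (intro exI[of _ "lin_comb n (records l) (\<lambda>bs. weight bs X / weight bs (1\<^sub>m 2)) (obs_proj l)"]
        exI[of _ "\<lambda>bs. weight bs X / weight bs (1\<^sub>m 2)"] conjI refl ballI)
qed

lemma ex_quotient_filter:
  assumes "l \<le> k"
  shows "\<exists>Q. is_quotient n (Y_alg l) (unnormalized l X) (unnormalized l (1\<^sub>m 2)) Q"
  unfolding is_quotient_filter_iff[OF assms]
  by (intro exI[of _ "lin_comb n (records l) (\<lambda>bs. weight bs X / weight bs (1\<^sub>m 2)) (obs_proj l)"]
      exI[of _ "\<lambda>bs. weight bs X / weight bs (1\<^sub>m 2)"] conjI refl ballI impI)

lemma linear_filtering:
  "(\<forall>X \<in> M2. \<forall>l \<le> k. \<exists>E. is_cond_exp n P (C_alg l) (heisenberg (V l) (sys k X)) E) \<and>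
   (\<forall>X \<in> M2. \<forall>l \<le> k. \<exists>p. is_cond_exp n P (Y_alg l) (heisenberg (U l) (sys k X)) p) \<and>
   (\<forall>\<sigma> :: nat \<Rightarrow> complex mat \<Rightarrow> complex mat.
     (\<forall>X \<in> M2. \<forall>l \<le> k. \<exists>E. is_cond_exp n P (C_alg l) (heisenberg (V l) (sys k X)) E \<and>
        \<sigma> l X = heisenberg (U l) E) \<longrightarrow>
     (\<forall>X \<in> M2. \<forall>l \<le> k. \<sigma> l X \<in> Y_alg l) \<and>
     (\<forall>X \<in> M2. \<forall>l \<in> {1..k}.
        \<sigma> l X - \<sigma> (l - 1) X =
          \<sigma> (l - 1) (lindblad lam Mp Mo X) * dt k lam l
          + \<sigma> (l - 1) (jump lam Mp Mo X) * heisenberg (U l) (noise l)) \<and>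
     (\<forall>X \<in> M2. \<sigma> 0 X = \<rho> X \<cdot>\<^sub>m 1\<^sub>m n) \<and>
     (\<forall>l \<le> k. as_nonzero n P (Y_alg l) (\<sigma> l (1\<^sub>m 2))) \<and>
     (\<forall>X \<in> M2. \<forall>l \<le> k.
        (\<exists>Q. is_quotient n (Y_alg l) (\<sigma> l X) (\<sigma> l (1\<^sub>m 2)) Q) \<and>
        (\<forall>Q p. is_quotient n (Y_alg l) (\<sigma> l X) (\<sigma> l (1\<^sub>m 2)) Q \<longrightarrow>
           is_cond_exp n P (Y_alg l) (heisenberg (U l) (sys k X)) p \<longrightarrow> as_eq P p Q)))"
proof (intro conjI allI impI ballI)
  show "\<exists>E. is_cond_exp n P (C_alg l) (heisenberg (V l) (sys k X)) E" if "X \<in> M2" "l \<le> k" for X l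
    using cond_exp_noise_iff[OF that(2,1)] by blast
  show "\<exists>p. is_cond_exp n P (Y_alg l) (heisenberg (U l) (sys k X)) p" if "X \<in> M2" "l \<le> k" for X l
    by (rule ex_cond_exp_observation[OF that(2,1)])
next
  fix \<sigma> :: "nat \<Rightarrow> complex mat \<Rightarrow> complex mat"
  assume \<sigma>: "\<forall>X \<in> M2. \<forall>l \<le> k. \<exists>E. is_cond_exp n P (C_alg l) (heisenberg (V l) (sys k X)) E \<and>
        \<sigma> l X = heisenberg (U l) E"
  \<comment> \<open>Uniqueness given the noise algebra turns the defining property of an arbitrary
    \<sigma> into an explicit formula.\<close>
  have est: "\<sigma> l X = heisenberg (U l) (estimate l X)" if "X \<in> M2" "l \<le> k" for X l
  proof -
    obtain E where "is_cond_exp n P (C_alg l) (heisenberg (V l) (sys k X)) E" "\<sigma> l X = heisenberg (U l) E"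
      using \<sigma> \<open>X \<in> M2\<close> \<open>l \<le> k\<close> by blast
    then show ?thesis using cond_exp_noise_iff[OF that(2,1)] by simp
  qed
  then have fil: "\<sigma> l X = unnormalized l X" if "X \<in> M2" "l \<le> k" for X l
    using that by (simp add: heisenberg_estimate)
  have one: "1\<^sub>m 2 \<in> M2" by simp
  show "\<sigma> l X \<in> Y_alg l" if "X \<in> M2" "l \<le> k" for X l
    unfolding fil[OF that] observation_star_alg[OF that(2)] by blast
  show "\<sigma> l X - \<sigma> (l - 1) X = \<sigma> (l - 1) (lindblad lam Mp Mo X) * dt k lam l
      + \<sigma> (l - 1) (jump lam Mp Mo X) * heisenberg (U l) (noise l)" if "X \<in> M2" "l \<in> {1..k}" for X l
  proof -
    have "lindblad lam Mp Mo X \<in> M2" "jump lam Mp Mo X \<in> M2"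
      using M that by (simp_all add: lindblad_def jump_def)
    moreover have "1 \<le> l" "l \<le> k" "l - 1 \<le> k" using that by auto
    ultimately show ?thesis
      using filter_recursion[OF \<open>1 \<le> l\<close> \<open>l \<le> k\<close> \<open>X \<in> M2\<close>] that(1) by (simp only: est)
  qed
  show "\<sigma> 0 X = \<rho> X \<cdot>\<^sub>m 1\<^sub>m n" if "X \<in> M2" for X
    using est[OF that, of 0] estimate_0[OF that] by simp
  show "as_nonzero n P (Y_alg l) (\<sigma> l (1\<^sub>m 2))" if "l \<le> k" for l
    unfolding fil[OF one that] by (rule filter_as_nonzero[OF that])
  show "\<exists>Q. is_quotient n (Y_alg l) (\<sigma> l X) (\<sigma> l (1\<^sub>m 2)) Q" if "X \<in> M2" "l \<le> k" for X l
    unfolding fil[OF that] fil[OF one that(2)] by (rule ex_quotient_filter[OF that(2)])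
  show "as_eq P p Q" if "X \<in> M2" "l \<le> k" "is_quotient n (Y_alg l) (\<sigma> l X) (\<sigma> l (1\<^sub>m 2)) Q"
    "is_cond_exp n P (Y_alg l) (heisenberg (U l) (sys k X)) p" for X l Q p
    using that(3,4) unfolding fil[OF that(1,2)] fil[OF one that(2)]
    by (rule cond_exp_eq_quotient[OF that(2,1)])
qed

end

theorem theorem6p4:
  fixes k :: nat and T lam :: real and \<rho> P :: "complex mat \<Rightarrow> complex"
    and L1 L2 L3 Mpm Mp Mm Mo :: "complex mat"
    and U V dY :: "nat \<Rightarrow> complex mat"
    and C Y :: "nat \<Rightarrow> complex mat set"
  assumes k: "k \<ge> 1" and T: "T > 0" and lam: "lam = sqrt (T / real k)"
    and \<rho>: "is_state 2 \<rho>" and P: "P = prod_state \<rho> k"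
    and L: "L1 \<in> M2" "L2 \<in> M2" "L3 \<in> M2" "mat_adjoint L1 = L1" "mat_adjoint L3 = L3"
    and M: "Mpm \<in> M2" "Mp \<in> M2" "Mm \<in> M2" "Mo \<in> M2"
    and M_decomp: "\<And>l. 1 \<le> l \<Longrightarrow> l \<le> k \<Longrightarrow>
      interaction k lam L1 L2 L3 l - 1\<^sub>m (fulldim k) =
        sys k Mpm * dLambda k l + sys k Mp * dAstar k lam l
        + sys k Mm * dA k lam l + sys k Mo * dt k lam l"
    and U: "U = evolution k lam L1 L2 L3"
    and V: "V = change_op k lam Mp Mo"
    and dY: "dY = (\<lambda>l. heisenberg (U l) (dA k lam l + dAstar k lam l))"
    and C: "C = (\<lambda>l. star_alg (fulldim k) ((\<lambda>i. dA k lam i + dAstar k lam i) ` {1..l}))"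
    and Y: "Y = (\<lambda>l. star_alg (fulldim k) (dY ` {1..l}))"
  shows
    "(\<forall>X \<in> M2. \<forall>l \<le> k. \<exists>E. is_cond_exp (fulldim k) P (C l) (heisenberg (V l) (sys k X)) E) \<and>
     (\<forall>X \<in> M2. \<forall>l \<le> k. \<exists>\<pi>. is_cond_exp (fulldim k) P (Y l) (heisenberg (U l) (sys k X)) \<pi>) \<and>
     (\<forall>\<sigma> :: nat \<Rightarrow> complex mat \<Rightarrow> complex mat.
       (\<forall>X \<in> M2. \<forall>l \<le> k. \<exists>E. is_cond_exp (fulldim k) P (C l) (heisenberg (V l) (sys k X)) E \<and>
          \<sigma> l X = heisenberg (U l) E) \<longrightarrow>
       (\<forall>X \<in> M2. \<forall>l \<le> k. \<sigma> l X \<in> Y l) \<and>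
       (\<forall>X \<in> M2. \<forall>l \<in> {1..k}.
          \<sigma> l X - \<sigma> (l - 1) X =
            \<sigma> (l - 1) (lindblad lam Mp Mo X) * dt k lam l + \<sigma> (l - 1) (jump lam Mp Mo X) * dY l) \<and>
       (\<forall>X \<in> M2. \<sigma> 0 X = \<rho> X \<cdot>\<^sub>m 1\<^sub>m (fulldim k)) \<and>
       (\<forall>l \<le> k. as_nonzero (fulldim k) P (Y l) (\<sigma> l (1\<^sub>m 2))) \<and>
       (\<forall>X \<in> M2. \<forall>l \<le> k.
          (\<exists>Q. is_quotient (fulldim k) (Y l) (\<sigma> l X) (\<sigma> l (1\<^sub>m 2)) Q) \<and>
          (\<forall>Q \<pi>. is_quotient (fulldim k) (Y l) (\<sigma> l X) (\<sigma> l (1\<^sub>m 2)) Q \<longrightarrow>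
             is_cond_exp (fulldim k) P (Y l) (heisenberg (U l) (sys k X)) \<pi> \<longrightarrow>
             as_eq P \<pi> Q)))"
proof -
  have "lam \<noteq> 0" using k T lam by simp
  \<comment> \<open>The locale uses the simplified dimension \<open>2 * 2 ^ k\<close>; the rewriting
    restores \<open>fulldim k\<close>.\<close>
  then interpret repeated_interaction k lam \<rho> L1 L2 L3 Mpm Mp Mm Mo
    rewrites "2 * 2 ^ k \<equiv> fulldim k"
    using \<rho> L M M_decomp by unfold_locales simp_all
  show ?thesis
    unfolding U V C Y dY P by (rule linear_filtering)
qed

end
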